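(* Let $x_0<x_1<x_2$, and set $X_1=(x_0,x_1)$, $X_2=(x_1,x_2)$ and $X=(x_0,x_2)$. Let $\zeta\in\mathrm{Reg}_+(X)$ be continuous at $x_1$, and let $\widetilde\zeta\in\mathrm{Step}_+(X)$ be given by $\widetilde\zeta(x)=1+cH(x-x_1)$ $(x\in X)$, where $c>-1$ and $H$ is the Heaviside function. Set $\zeta_1=\zeta|_{X_1}$, $\zeta_2=\zeta|_{X_2}$ and $$r=\frac{\widetilde\zeta(x_1-)-\widetilde\zeta(x_1+)}{\widetilde\zeta(x_1-)+\widetilde\zeta(x_1+)}.$$ Then $$g_\zeta=g_{\zeta_1}\circ g_{\zeta_2}\quad\text{and}\quad g_{\zeta\widetilde\zeta}=g_{\zeta_1}\circ\varphi_{1,r}\circ g_{\zeta_2},$$ meaning that for almost every $\omega\in\mathbb{R}$ the corresponding identities $g_\zeta^\omega=g_{\zeta_1}^\omega\circ g_{\zeta_2}^\omega$ and $g_{\zeta\widetilde\zeta}^\omega=g_{\zeta_1}^\omega\circ\varphi_{1,r}\circ g_{\zeta_2}^\omega$ hold as maps on $\mathbb{D}$.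
   Context: $\mathbb{D}$ is the open unit disk; $\varphi_{\mu,\rho}(\xi)=\mu\frac{\xi+\rho}{1+\bar\rho\xi}$ for $\mu\in S^1$ (unit circle) and $\rho\in\mathbb{D}$. $K$ is the set of all the maps $\varphi_{\mu,\rho}$ together with all constant maps with value in $S^1$; elements of $K$ extend continuously to the closed disk, so compositions of elements of $K$ make sense. For a bounded interval $Y$: $\mathrm{Step}(Y)$ is the set of piecewise-constant complex-valued functions on $Y$ with finitely many discontinuities, $\mathrm{Step}_+(Y)$ the strictly positive ones; $\mathrm{Reg}(Y)$ is the closure of $\mathrm{Step}(Y)$ in $L^\infty(Y)$; $\mathrm{Reg}_+(Y)=\{f\in\mathrm{Reg}(Y): \exists\varepsilon>0,\ f>\varepsilon \text{ on } Y\}$. One-sided limits are written $f(x\pm)$. Generalized reflection coefficient: for $\omega\in\mathbb{R}\setminus\{0\}$ put $u^{\ell}=\frac12\bigl(u-\frac{1}{i\omega}u'\bigr)$ and $u^{\rm r}=\frac12\bigl(u+\frac{1}{i\omega}u'\bigr)$. For $Y=(a,b)$ and $\eta\in\mathrm{Reg}_+(Y)$, for all $\omega\in\mathbb{R}$ outside a countable set (containing $0$) and every $\xi\in\mathbb{D}$, the problem $(\eta u')'+\omega^2\eta u=0$ on $Y$, $u^{\rm r}(a+)=1$, $u^{\ell}(b-)=\xi u^{\rm r}(b-)$ has a unique solution $u$ with $u$ and $\eta u'$ absolutely continuous (equation holding a.e.); one defines $g_\eta^\omega(\xi)=u^{\ell}(a+)$, and $g_\eta^\omega\in K$. $g_\eta$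 denotes the a.e.-defined map $\omega\mapsto g_\eta^\omega$. *)

theory Defs
  imports "HOL-Analysis.Analysis"
begin

text \<open>A function on an interval \<open>Y\<close> is a total function of which only the values on \<open>Y\<close> matter.
  Elements of \<open>L\<^sup>\<infinity>(Y)\<close> are given by representatives, so conditions on them hold up to null sets.\<close>

definition Step :: "real set \<Rightarrow> (real \<Rightarrow> complex) set" where
  "Step Y = {s. \<exists>F. finite F \<and> (\<forall>C \<in> components (Y - F). s constant_on C)}"

definition Step_pos :: "real set \<Rightarrow> (real \<Rightarrow> real) set" where
  "Step_pos Y = {s. (\<lambda>x. complex_of_real (s x)) \<in> Step Y \<and> (\<forall>x\<in>Y. s x > 0)}"

definition Reg :: "real set \<Rightarrow> (real \<Rightarrow> complex) set" where
  "Reg Y = {f \<in> borel_measurable (lebesgue_on Y).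
     \<forall>\<epsilon>>0. \<exists>s\<in>Step Y. AE x in lebesgue_on Y. norm (f x - s x) \<le> \<epsilon>}"

definition Reg_pos :: "real set \<Rightarrow> (real \<Rightarrow> real) set" where
  "Reg_pos Y = {f. (\<lambda>x. complex_of_real (f x)) \<in> Reg Y \<and>
     (\<exists>\<epsilon>>0. AE x in lebesgue_on Y. f x > \<epsilon>)}"

text \<open>Continuity at a point of an element of \<open>L\<^sup>\<infinity>(Y)\<close>: some representative is continuous there.\<close>

definition ae_continuous_at :: "real set \<Rightarrow> (real \<Rightarrow> real) \<Rightarrow> real \<Rightarrow> bool" where
  "ae_continuous_at Y f x \<longleftrightarrow> (\<exists>h. (AE y in lebesgue_on Y. h y = f y) \<and> isCont h x)"

definition heaviside :: "real \<Rightarrow> real" where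
  "heaviside x = (if x < 0 then 0 else 1)"

text \<open>The usual epsilon-delta notion. The members of a division are compact intervals
  \<open>K = {Inf K..Sup K}\<close> with disjoint interiors.\<close>

definition abs_continuous_on :: "real set \<Rightarrow> (real \<Rightarrow> complex) \<Rightarrow> bool" where
  "abs_continuous_on Y f \<longleftrightarrow> (\<forall>\<epsilon>>0. \<exists>\<delta>>0. \<forall>d T. d division_of T \<and> T \<subseteq> Y \<and> (\<Sum>K\<in>d. Sup K - Inf K) < \<delta>
     \<longrightarrow> (\<Sum>K\<in>d. norm (f (Sup K) - f (Inf K))) < \<epsilon>)"

definition left_part :: "real \<Rightarrow> (real \<Rightarrow> complex) \<Rightarrow> real \<Rightarrow> complex" where
  "left_part \<omega> u x = 1/2 * (u x - 1 / (\<i> * of_real \<omega>) * vector_derivative u (at x))"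

definition right_part :: "real \<Rightarrow> (real \<Rightarrow> complex) \<Rightarrow> real \<Rightarrow> complex" where
  "right_part \<omega> u x = 1/2 * (u x + 1 / (\<i> * of_real \<omega>) * vector_derivative u (at x))"

text \<open>The derivative of \<open>u\<close> exists only almost everywhere on \<open>(a, b)\<close>; with \<open>p\<close> an end point, this
  filter gives the one-sided limit at \<open>p\<close>, from inside, of functions defined where \<open>u'\<close> exists.\<close>

definition end_filter :: "real \<Rightarrow> real \<Rightarrow> (real \<Rightarrow> complex) \<Rightarrow> real \<Rightarrow> real filter" where
  "end_filter a b u p = at p within {x \<in> {a<..<b}. u differentiable (at x)}"

text \<open>Absolute continuity of \<open>\<eta>u'\<close>, an almost everywhere defined function, means that it coincides
  almost everywhere with an absolutely continuous function \<open>v\<close>.\<close>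

definition scattering_solution ::
  "real \<Rightarrow> real \<Rightarrow> (real \<Rightarrow> real) \<Rightarrow> real \<Rightarrow> complex \<Rightarrow> (real \<Rightarrow> complex) \<Rightarrow> bool" where
  "scattering_solution a b \<eta> \<omega> \<xi> u \<longleftrightarrow>
     abs_continuous_on {a<..<b} u \<and>
     (\<exists>v. abs_continuous_on {a<..<b} v \<and>
       (AE x in lebesgue_on {a<..<b}.
          u differentiable (at x) \<and> v x = of_real (\<eta> x) * vector_derivative u (at x) \<and>
          v differentiable (at x) \<and>
          vector_derivative v (at x) + (of_real \<omega>)\<^sup>2 * of_real (\<eta> x) * u x = 0)) \<and>
     (right_part \<omega> u \<longlongrightarrow> 1) (end_filter a b u a) \<and>
     (\<exists>L R. (left_part \<omega> u \<longlongrightarrow> L) (end_filter a b u b) \<and>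
            (right_part \<omega> u \<longlongrightarrow> R) (end_filter a b u b) \<and> L = \<xi> * R)"

definition refl_coeff :: "real \<Rightarrow> real \<Rightarrow> (real \<Rightarrow> real) \<Rightarrow> real \<Rightarrow> complex \<Rightarrow> complex" where
  "refl_coeff a b \<eta> \<omega> \<xi> =
     (THE w. \<exists>u. scattering_solution a b \<eta> \<omega> \<xi> u \<and> (left_part \<omega> u \<longlongrightarrow> w) (end_filter a b u a))"

definition disk_auto :: "complex \<Rightarrow> complex \<Rightarrow> complex \<Rightarrow> complex" where
  "disk_auto \<mu> \<rho> \<xi> = \<mu> * ((\<xi> + \<rho>) / (1 + cnj \<rho> * \<xi>))"

text \<open>Maps on the open unit disk are composed through their continuous extensions to the closed
  disk, since the inner map may be a constant on the unit circle.\<close>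

definition disk_ext :: "(complex \<Rightarrow> complex) \<Rightarrow> complex \<Rightarrow> complex" where
  "disk_ext f z = (if z \<in> ball 0 1 then f z else Lim (at z within ball 0 1) f)"

definition disk_comp :: "(complex \<Rightarrow> complex) \<Rightarrow> (complex \<Rightarrow> complex) \<Rightarrow> complex \<Rightarrow> complex"
  (infixr "\<circ>\<^sub>D" 55) where
  "(f \<circ>\<^sub>D g) \<xi> = disk_ext f (g \<xi>)"

end

theory Submission
  imports Defs
begin

text \<open>For \<open>\<omega> \<noteq> 0\<close> the pair \<open>(U, V) = (u, \<eta>u')\<close> solves a linear system with bounded coefficients, so a
  solution with prescribed data at the right end exists on the whole interval. The Wronskian of two
  solutions is constant; applied to a solution and its conjugate this makes
  \<open>\<eta>(|u\<^sup>r|\<^sup>2 - |u\<^sup>\<ell>|\<^sup>2)\<close> constant, so \<open>u\<^sup>\<ell>/u\<^sup>r\<close> stays in the disk, and applied to two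
  solutions of the scattering problem it shows that \<open>u\<^sup>\<ell>(a+)\<close> is unique. Hence \<open>g\<close> maps the ratio
  \<open>u\<^sup>\<ell>/u\<^sup>r\<close> at the right end to the same ratio at the left end. Restricting one solution to both
  subintervals gives the composition: at \<open>x\<^sub>1\<close> both \<open>U\<close> and \<open>V\<close> are continuous, so a jump of \<open>\<eta>\<close> from \<open>C\<^sub>1\<close>
  to \<open>C\<^sub>2\<close> changes the ratio by \<open>\<phi>\<close> with parameters \<open>1\<close> and \<open>(C\<^sub>1 - C\<^sub>2)/(C\<^sub>1 + C\<^sub>2)\<close>.\<close>

subsection \<open>Absolutely continuous functions\<close>

text \<open>The scattering problem is a two-point problem, but it prescribes at the right end only a
  ratio. So the initial value problem is solved from the right end with data of ratio \<xi>, and the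
  result is divided by the value of \<open>right_part\<close> at the left end. This value is nonzero
  because the conserved quantity keeps the left part smaller in norm than the right part when \<xi>
  is in the open disk and \<omega> \<noteq> 0. Hence the identities hold for every \<omega> \<noteq>
  0, and each inner value of a composition lies in the open disk, where \<open>disk_ext\<close> is
  evaluation. The obstacle is that the equation and the regularity of \<eta> are known only off null
  sets, whereas the end limits in \<open>scattering_solution\<close> run over all points where
  \<open>u\<close> is differentiable. The remedy is a mean value inequality with a null exceptional
  set, \<open>abs_continuous_on_norm_diff_le\<close>: it makes solutions Lipschitz, makes the
  Wronskian constant, and controls the derivative at every point where it exists.\<close>

lemma AE_lebesgue_on_interval_iff:
  fixes a b :: real
  shows "(AE x in lebesgue_on {a<..<b}. P x) \<longleftrightarrow> (\<exists>N. negligible N \<and> (\<forall>x\<in>{a<..<b} - N. P x))"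
proof -
  have "(AE x in lebesgue_on {a<..<b}. P x) \<longleftrightarrow> (AE x in lebesgue. x \<in> {a<..<b} \<longrightarrow> P x)"
    by (rule AE_restrict_space_iff) simp
  also have "\<dots> \<longleftrightarrow> (\<exists>N. negligible N \<and> {x. \<not> (x \<in> {a<..<b} \<longrightarrow> P x)} \<subseteq> N)"
    by (rule eventually_ae_filter_negligible)
  also have "\<dots> \<longleftrightarrow> (\<exists>N. negligible N \<and> (\<forall>x\<in>{a<..<b} - N. P x))"
    by (rule arg_cong[where f = Ex], rule ext) blast
  finally show ?thesis .
qed

lemma division_of_real_intervalE:
  fixes S :: "real set"
  assumes "d division_of S" "K \<in> d"
  obtains x y where "x \<le> y" "K = {x..y}" "x \<in> S" "y \<in> S" "Inf K = x" "Sup K = y"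
proof -
  obtain x y where "K = cbox x y" and "K \<noteq> {}" and "K \<subseteq> S"
    using division_ofD(2,3,4)[OF assms(1) assms(2)] by metis
  then show ?thesis using that[of x y] by (auto simp: subset_iff)
qed

lemma lipschitz_on_imp_abs_continuous_on:
  assumes "C-lipschitz_on Y f"
  shows "abs_continuous_on Y f"
  unfolding abs_continuous_on_def
proof (intro allI impI)
  fix \<epsilon> :: real assume "\<epsilon> > 0"
  have C: "C \<ge> 0" using assms by (rule lipschitz_on_nonneg)
  show "\<exists>\<delta>>0. \<forall>d T. d division_of T \<and> T \<subseteq> Y \<and> (\<Sum>K\<in>d. Sup K - Inf K) < \<delta>
     \<longrightarrow> (\<Sum>K\<in>d. norm (f (Sup K) - f (Inf K))) < \<epsilon>"
  \<comment> \<open>\<open>C + 1\<close> replaces \<open>C\<close> in the denominator because the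
    Lipschitz constant may be 0.\<close>
  proof (intro exI[of _ "\<epsilon> / (C + 1)"] conjI allI impI)
    show "\<epsilon> / (C + 1) > 0" using C \<open>\<epsilon> > 0\<close> by simp
    fix d T assume *: "d division_of T \<and> T \<subseteq> Y \<and> (\<Sum>K\<in>d. Sup K - Inf K) < \<epsilon> / (C + 1)"
    have le: "norm (f (Sup K) - f (Inf K)) \<le> C * (Sup K - Inf K)" "0 \<le> Sup K - Inf K" if K: "K \<in> d" for K
    proof -
      obtain x y where xy: "x \<le> y" "x \<in> T" "y \<in> T" "Inf K = x" "Sup K = y"
        using division_of_real_intervalE[of d T K] * K by metis
      then have "dist (f y) (f x) \<le> C * dist y x" using * assms by (meson lipschitz_onD subsetD)
      then show "norm (f (Sup K) - f (Inf K)) \<le> C * (Sup K - Inf K)" "0 \<le> Sup K - Inf K"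
        using xy by (auto simp: dist_norm)
    qed
    have "(\<Sum>K\<in>d. norm (f (Sup K) - f (Inf K))) \<le> (\<Sum>K\<in>d. C * (Sup K - Inf K))"
      by (intro sum_mono le)
    also have "\<dots> = C * (\<Sum>K\<in>d. Sup K - Inf K)" by (simp add: sum_distrib_left)
    also have "\<dots> \<le> (C + 1) * (\<Sum>K\<in>d. Sup K - Inf K)"
      by (intro mult_right_mono sum_nonneg le) auto
    also have "\<dots> < \<epsilon>" using * C by (simp add: field_simps)
    finally show "(\<Sum>K\<in>d. norm (f (Sup K) - f (Inf K))) < \<epsilon>" .
  qed
qed

text \<open>A division with the single member \<open>{x..y}\<close> already tests continuity, and
  convexity keeps this interval inside \<open>Y\<close>. Uniform continuity is what later allows
  extension to the closed interval.\<close>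

lemma abs_continuous_on_imp_uniformly_continuous_on:
  assumes "abs_continuous_on Y f" and Y: "convex Y"
  shows "uniformly_continuous_on Y f"
  unfolding uniformly_continuous_on_def
proof (intro allI impI)
  fix \<epsilon> :: real assume "\<epsilon> > 0"
  then obtain \<delta> where \<delta>: "\<delta> > 0" and *: "\<And>d T. d division_of T \<Longrightarrow> T \<subseteq> Y \<Longrightarrow> (\<Sum>K\<in>d. Sup K - Inf K) < \<delta>
     \<Longrightarrow> (\<Sum>K\<in>d. norm (f (Sup K) - f (Inf K))) < \<epsilon>"
    using assms unfolding abs_continuous_on_def by meson
  have le: "norm (f y - f x) < \<epsilon>" if "x \<in> Y" "y \<in> Y" "x \<le> y" "y - x < \<delta>" for x y
  proof -
    have "{cbox x y} division_of cbox x y" using that by (intro division_of_self) simp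
    moreover have "cbox x y \<subseteq> Y"
      using Y that by (metis box_real(2) closed_segment_eq_real_ivl closed_segment_subset)
    ultimately show ?thesis using *[of "{cbox x y}" "cbox x y"] that by simp
  qed
  show "\<exists>d>0. \<forall>x\<in>Y. \<forall>x'\<in>Y. dist x' x < d \<longrightarrow> dist (f x') (f x) < \<epsilon>"
  proof (intro exI[of _ \<delta>] conjI ballI impI \<delta>)
    fix x x' assume "x \<in> Y" "x' \<in> Y" "dist x' x < \<delta>"
    then show "dist (f x') (f x) < \<epsilon>"
      using le[of x x'] le[of x' x] by (cases "x \<le> x'") (auto simp: dist_norm norm_minus_commute)
  qed
qed

text \<open>In a fine tagged division, the intervals tagged outside \<open>N\<close> are controlled by the derivative, and
  those tagged in \<open>N\<close> lie in a small open cover of \<open>N\<close> and are controlled by absolute continuity.\<close>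

lemma abs_continuous_on_norm_diff_le:
  fixes f :: "real \<Rightarrow> complex"
  assumes ac: "abs_continuous_on S f" and sub: "{x..y} \<subseteq> S" and "x \<le> y" and N: "negligible N" and "M \<ge> 0"
    and deriv: "\<And>t. t \<in> {x..y} - N \<Longrightarrow>
      \<exists>D. (f has_vector_derivative D) (at t) \<and> norm (D - L) \<le> M"
  shows "norm (f y - f x - (y - x) *\<^sub>R L) \<le> M * (y - x)"
proof -
  define N' where "N' = N \<inter> {x..y}"
  have N': "negligible N'" "N' \<in> lmeasurable"
    using N by (auto simp: N'_def negligible_Int intro: negligible_imp_measurable)
  \<comment> \<open>Subtracting the line of slope \<open>L\<close> turns the claim into a bound for
    the increment of \<open>g\<close>, whose derivative has norm at most \<open>M\<close> off
    \<open>N\<close>.\<close>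
  define g where "g t = f t - t *\<^sub>R L" for t
  have bound: "norm (g y - g x) \<le> (M + e) * (y - x) + e + e * norm L" if "e > 0" for e
  proof -
    obtain \<delta> where \<delta>: "\<delta> > 0" and ac\<delta>: "\<And>d T. d division_of T \<Longrightarrow> T \<subseteq> S \<Longrightarrow>
        (\<Sum>K\<in>d. Sup K - Inf K) < \<delta> \<Longrightarrow> (\<Sum>K\<in>d. norm (f (Sup K) - f (Inf K))) < e"
      using ac \<open>e > 0\<close> unfolding abs_continuous_on_def by meson
    \<comment> \<open>Intervals tagged in \<open>N'\<close> will have total length below
      \<open>\<delta>'\<close>: the bound \<open>\<delta>\<close> serves the increments of
      \<open>f\<close>, the bound \<open>e\<close> those of the linear term.\<close>
    define \<delta>' where "\<delta>' = min \<delta> e"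
    have "\<delta>' > 0" using \<delta> \<open>e > 0\<close> by (simp add: \<delta>'_def)
    obtain U where U: "open U" "N' \<subseteq> U" "U - N' \<in> lmeasurable" "emeasure lebesgue (U - N') < ennreal \<delta>'"
      using sets_lebesgue_outer_open[OF fmeasurableD[OF N'(2)] \<open>\<delta>' > 0\<close>] by metis
    have Uleb: "U \<in> lmeasurable"
    proof -
      have "U = (U - N') \<union> N'" using U(2) by blast
      then show ?thesis using U(3) N'(2) by (metis fmeasurable.Un)
    qed
    have mU: "measure lebesgue U < \<delta>'"
    proof -
      have "measure lebesgue U = measure lebesgue (U - N')"
        using N'(1) Uleb by (simp add: measure_Diff_null_set negligible_iff_null_sets fmeasurableD)
      then show ?thesis using U(3,4) \<open>\<delta>' > 0\<close> by (metis emeasure_eq_measure2 ennreal_less_iff measure_nonneg)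
    qed
    \<comment> \<open>\<open>Q t R\<close> says that \<open>R\<close> is an admissible gauge
      neighbourhood of the tag \<open>t\<close>: inside the small cover for tags in
      \<open>N'\<close>, within the range of the derivative estimate for the other tags of the
      interval.\<close>
    define Q where "Q t R \<longleftrightarrow> open R \<and> t \<in> R \<and> (t \<in> N' \<longrightarrow> R \<subseteq> U) \<and>
        (t \<in> {x..y} - N' \<longrightarrow> (\<forall>s\<in>R. norm (g s - g t) \<le> (M + e) * \<bar>s - t\<bar>))" for t R
    have "\<exists>R. Q t R" for t
    proof (cases "t \<in> {x..y} - N'")
      case True
      then obtain D where D: "(f has_vector_derivative D) (at t)" "norm (D - L) \<le> M"
        using deriv[of t] by (auto simp: N'_def)
      have "(g has_vector_derivative D - L) (at t)"
        unfolding g_def by (auto intro!: derivative_eq_intros D)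
      then obtain d where d: "d > 0" and
        *: "\<And>s. \<bar>s - t\<bar> < d \<Longrightarrow> norm (g s - g t - (s - t) *\<^sub>R (D - L)) \<le> e * \<bar>s - t\<bar>"
        unfolding has_vector_derivative_def has_derivative_at_alt using \<open>e > 0\<close> by auto
      have "norm (g s - g t) \<le> (M + e) * \<bar>s - t\<bar>" if "\<bar>s - t\<bar> < d" for s
      proof -
        have "norm (g s - g t) \<le> norm (g s - g t - (s - t) *\<^sub>R (D - L)) + norm ((s - t) *\<^sub>R (D - L))"
          by (metis add.commute norm_triangle_sub)
        also have "\<dots> \<le> e * \<bar>s - t\<bar> + \<bar>s - t\<bar> * M"
          using *[OF that] D(2) by (intro add_mono) (auto intro: mult_left_mono)
        finally show ?thesis by (simp add: algebra_simps)
      qed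
      then have "Q t (ball t d)" using True d by (auto simp: Q_def dist_real_def abs_minus_commute)
      then show ?thesis ..
    next
      case False
      then show ?thesis
        using U(1,2) by (cases "t \<in> N'") (auto simp: Q_def subset_iff)
    qed
    then obtain \<gamma> where \<gamma>: "\<And>t. Q t (\<gamma> t)" by metis
    then have "gauge \<gamma>" by (auto simp: gauge_def Q_def)
    then obtain p where p: "p tagged_division_of {x..y}" "\<gamma> fine p"
      by (rule fine_division_exists_real)
    have fin: "finite p" using p(1) by blast
    have pK: "\<exists>u v. K = {u..v} \<and> u \<le> t \<and> t \<le> v \<and> x \<le> u \<and> v \<le> y \<and> Inf K = u \<and> Sup K = v \<and> K \<subseteq> \<gamma> t"
      if "(t, K) \<in> p" for t K
    proof -
      obtain u v where "K = cbox u v" using tagged_division_ofD(4)[OF p(1)] \<open>(t, K) \<in> p\<close> by blast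
      moreover have "t \<in> K" "K \<subseteq> {x..y}" using tagged_division_ofD(2,3)[OF p(1)] \<open>(t, K) \<in> p\<close> by auto
      moreover have "K \<subseteq> \<gamma> t" using p(2) \<open>(t, K) \<in> p\<close> by (auto simp: fine_def)
      ultimately show ?thesis by (intro exI[of _ u] exI[of _ v]) auto
    qed
    define A where "A = {(t, K) \<in> p. t \<in> N'}"
    have A: "A \<subseteq> p" "finite A" using fin by (auto simp: A_def intro: finite_subset)
    define d where "d = snd ` A"
    have Atag: "A tagged_division_of \<Union>d"
      unfolding d_def
      using p(1)[unfolded tagged_division_of_def]
      by (blast intro: tagged_partial_division_of_Union_self tagged_partial_division_subset[OF _ A(1)])
    have ddiv: "d division_of \<Union>d"
      unfolding d_def using Atag d_def division_of_tagged_division by metis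
    have dsub: "\<Union>d \<subseteq> {x..y}" using p(1) A(1) by (fastforce simp: d_def)
    have dU: "\<Union>d \<subseteq> U"
    proof -
      have "K \<subseteq> U" if "(t, K) \<in> A" for t K
        using \<gamma>[of t] pK[of t K] that by (auto simp: A_def Q_def)
      then show ?thesis by (fastforce simp: d_def)
    qed
    have len: "Sup K - Inf K = measure lebesgue K" if K: "K \<in> d" for K
    proof -
      obtain u v where "u \<le> v" "K = {u..v}" using division_of_real_intervalE[OF ddiv K] by metis
      then show ?thesis by simp
    qed
    have "(\<Sum>K\<in>d. Sup K - Inf K) = measure lebesgue (\<Union>d)"
      using content_division[OF ddiv] by (simp add: len cong: sum.cong)
    also have "\<dots> \<le> measure lebesgue U"
      using dU Uleb ddiv by (intro measure_mono_fmeasurable) (auto intro: lmeasurable_division fmeasurableD)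
    also have "\<dots> < \<delta>'" by (rule mU)
    finally have short: "(\<Sum>K\<in>d. Sup K - Inf K) < \<delta>'" .
    \<comment> \<open>An interval can carry two different tags only if it is degenerate, so both
      sums agree when \<open>h\<close> vanishes on degenerate intervals.\<close>
    have sumA: "(\<Sum>(t, K)\<in>A. h K) = (\<Sum>K\<in>d. h K)"
      if "\<And>u v. v \<le> u \<Longrightarrow> h {u..v} = (0::real)" for h
      unfolding d_def by (rule sum.over_tagged_division_lemma[OF Atag]) (use that in auto)
    have I: "norm (\<Sum>(t, K)\<in>p - A. g (Sup K) - g (Inf K)) \<le> (M + e) * (y - x)"
    proof -
      have "norm (\<Sum>(t, K)\<in>p - A. g (Sup K) - g (Inf K)) \<le> (\<Sum>(t, K)\<in>p - A. (M + e) * (Sup K - Inf K))"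
      proof (rule sum_norm_le, clarify)
        fix t K assume tK: "(t, K) \<in> p" "(t, K) \<notin> A"
        obtain u v where uv: "K = {u..v}" "u \<le> t" "t \<le> v" "x \<le> u" "v \<le> y" "Inf K = u" "Sup K = v" "K \<subseteq> \<gamma> t"
          using pK[OF tK(1)] by blast
        have t: "t \<in> {x..y} - N'" using tK uv by (auto simp: A_def)
        have "v \<in> \<gamma> t" "u \<in> \<gamma> t" using uv(1,2,3,8) by auto
        then have "norm (g v - g t) \<le> (M + e) * \<bar>v - t\<bar>" "norm (g u - g t) \<le> (M + e) * \<bar>u - t\<bar>"
          using \<gamma>[of t] t by (auto simp: Q_def)
        then have "norm (g v - g u) \<le> (M + e) * (v - t) + (M + e) * (t - u)"
          using uv norm_triangle_ineq4[of "g v - g t" "g u - g t"] by simp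
        then show "norm (g (Sup K) - g (Inf K)) \<le> (M + e) * (Sup K - Inf K)"
          using uv by (simp add: algebra_simps)
      qed
      also have "\<dots> \<le> (\<Sum>(t, K)\<in>p. (M + e) * (Sup K - Inf K))"
      proof (rule sum_mono2[OF fin], blast)
        fix b assume "b \<in> p - (p - A)"
        then obtain t K where b: "b = (t, K)" "(t, K) \<in> p" by (cases b) auto
        then show "0 \<le> (case b of (t, K) \<Rightarrow> (M + e) * (Sup K - Inf K))"
          using pK[of t K] \<open>M \<ge> 0\<close> \<open>e > 0\<close> by auto
      qed
      also have "(\<Sum>(t, K)\<in>p. (M + e) * (Sup K - Inf K)) = (M + e) * (\<Sum>(t, K)\<in>p. Sup K - Inf K)"
        by (simp add: sum_distrib_left case_prod_unfold)
      also have "(\<Sum>(t, K)\<in>p. Sup K - Inf K) = y - x"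
        using additive_tagged_division_1[OF \<open>x \<le> y\<close> p(1), of "\<lambda>t. t"] by simp
      finally show ?thesis .
    qed
    have II: "norm (\<Sum>(t, K)\<in>A. g (Sup K) - g (Inf K)) \<le> e + e * norm L"
    proof -
      \<comment> \<open>The case distinction provides the value 0 on the empty interval, where
        \<open>Sup\<close> and \<open>Inf\<close> carry no information.\<close>
      let ?h = "\<lambda>K. if K = {} then 0 else norm (f (Sup K) - f (Inf K)) + norm L * (Sup K - Inf K)"
      have "norm (\<Sum>(t, K)\<in>A. g (Sup K) - g (Inf K)) \<le> (\<Sum>(t, K)\<in>A. ?h K)"
      proof (rule sum_norm_le, clarify)
        fix t K assume "(t, K) \<in> A"
        then obtain u v where uv: "K = {u..v}" "u \<le> t" "t \<le> v" "Inf K = u" "Sup K = v"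
          using pK[of t K] A(1) by blast
        have "g v - g u = (f v - f u) - (v - u) *\<^sub>R L" by (simp add: g_def algebra_simps)
        then have "norm (g v - g u) \<le> norm (f v - f u) + norm L * (v - u)"
          using uv norm_triangle_ineq4[of "f v - f u" "(v - u) *\<^sub>R L"] by (simp add: mult.commute)
        then show "norm (g (Sup K) - g (Inf K)) \<le> ?h K" using uv by simp
      qed
      also have "\<dots> = (\<Sum>K\<in>d. ?h K)" by (rule sumA) auto
      also have "\<dots> = (\<Sum>K\<in>d. norm (f (Sup K) - f (Inf K)) + norm L * (Sup K - Inf K))"
        using division_ofD(3)[OF ddiv] by (intro sum.cong) auto
      also have "\<dots> = (\<Sum>K\<in>d. norm (f (Sup K) - f (Inf K))) + norm L * (\<Sum>K\<in>d. Sup K - Inf K)"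
        by (simp add: sum.distrib sum_distrib_left)
      also have "\<dots> \<le> e + norm L * e"
      proof (intro add_mono mult_left_mono)
        show "(\<Sum>K\<in>d. norm (f (Sup K) - f (Inf K))) \<le> e"
          using ac\<delta>[OF ddiv] dsub sub short by (force simp: \<delta>'_def)
      qed (use short in \<open>auto simp: \<delta>'_def\<close>)
      finally show ?thesis by (simp add: mult.commute)
    qed
    have "g y - g x = (\<Sum>(t, K)\<in>p. g (Sup K) - g (Inf K))"
      using additive_tagged_division_1[OF \<open>x \<le> y\<close> p(1), of g] by simp
    also have "\<dots> = (\<Sum>(t, K)\<in>p - A. g (Sup K) - g (Inf K)) + (\<Sum>(t, K)\<in>A. g (Sup K) - g (Inf K))"
      by (rule sum.subset_diff[OF A(1) fin])
    finally show ?thesis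
      using norm_triangle_mono[OF I II] by simp
  qed
  have "norm (g y - g x) \<le> M * (y - x)"
  proof (rule tendsto_lowerbound)
    show "((\<lambda>e. (M + e) * (y - x) + e + e * norm L) \<longlongrightarrow> M * (y - x)) (at_right 0)"
      by (auto intro!: tendsto_eq_intros)
    show "\<forall>\<^sub>F e in at_right 0. norm (g y - g x) \<le> (M + e) * (y - x) + e + e * norm L"
      unfolding eventually_at_right_field using bound by (intro exI[of _ 1]) auto
  qed simp
  then show ?thesis by (simp add: g_def algebra_simps)
qed

subsection \<open>The first-order system and its Wronskian\<close>

text \<open>\<open>U\<close> and \<open>V\<close> live on the closed interval, so their values at
  the end points are the boundary data of \<open>u\<close> and \<open>\<eta>u'\<close>. For
  coefficients bounded above and away from zero, absolutely continuous solutions are Lipschitz, and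
  on a bounded interval this class is closed under products, as the Wronskian requires.\<close>

definition system_solution ::
  "real \<Rightarrow> real \<Rightarrow> (real \<Rightarrow> real) \<Rightarrow> real \<Rightarrow> (real \<Rightarrow> complex) \<Rightarrow> (real \<Rightarrow> complex) \<Rightarrow> bool" where
  "system_solution a b \<eta> \<omega> U V \<longleftrightarrow>
     (\<exists>C. C-lipschitz_on {a..b} U) \<and> (\<exists>C. C-lipschitz_on {a..b} V) \<and>
     (\<exists>N. negligible N \<and> (\<forall>x\<in>{a<..<b} - N.
        (U has_vector_derivative V x / of_real (\<eta> x)) (at x) \<and>
        (V has_vector_derivative - (of_real \<omega>)\<^sup>2 * of_real (\<eta> x) * U x) (at x)))"

lemma system_solution_subinterval:
  assumes "system_solution a b \<eta> \<omega> U V" "a \<le> a'" "b' \<le> b"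
  shows "system_solution a' b' \<eta> \<omega> U V"
proof -
  have "{a'..b'} \<subseteq> {a..b}" "{a'<..<b'} \<subseteq> {a<..<b}" using assms by auto
  then show ?thesis
    using assms(1) unfolding system_solution_def by (blast intro: lipschitz_on_subset)
qed

lemma system_solution_scale:
  assumes "system_solution a b \<eta> \<omega> U V"
  shows "system_solution a b \<eta> \<omega> (\<lambda>x. c * U x) (\<lambda>x. c * V x)"
proof -
  obtain C1 C2 N where "C1-lipschitz_on {a..b} U" "C2-lipschitz_on {a..b} V" and N: "negligible N" and
    d: "\<And>x. x \<in> {a<..<b} - N \<Longrightarrow> (U has_vector_derivative V x / of_real (\<eta> x)) (at x)"
       "\<And>x. x \<in> {a<..<b} - N \<Longrightarrow> (V has_vector_derivative - (of_real \<omega>)\<^sup>2 * of_real (\<eta> x) * U x) (at x)"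
    using assms unfolding system_solution_def by blast
  then have "(norm c * C1)-lipschitz_on {a..b} (\<lambda>x. c * U x)" "(norm c * C2)-lipschitz_on {a..b} (\<lambda>x. c * V x)"
    by (auto simp: lipschitz_on_def dist_norm norm_mult mult.assoc
        mult_left_mono right_diff_distrib[symmetric])
  moreover have "((\<lambda>x. c * U x) has_vector_derivative c * V x / of_real (\<eta> x)) (at x)"
     "((\<lambda>x. c * V x) has_vector_derivative - (of_real \<omega>)\<^sup>2 * of_real (\<eta> x) * (c * U x)) (at x)"
     if "x \<in> {a<..<b} - N" for x
    using has_vector_derivative_mult_right[OF d(1)[OF that], of c]
      has_vector_derivative_mult_right[OF d(2)[OF that], of c] by (simp_all add: mult.left_commute)
  ultimately show ?thesis using N unfolding system_solution_def by blast
qed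

text \<open>The coefficients are real because \<omega> and \<eta> are. Pairing a solution with its
  conjugate in the Wronskian gives the conserved energy.\<close>

lemma system_solution_cnj:
  assumes "system_solution a b \<eta> \<omega> U V"
  shows "system_solution a b \<eta> \<omega> (\<lambda>x. cnj (U x)) (\<lambda>x. cnj (V x))"
proof -
  obtain C1 C2 N where "C1-lipschitz_on {a..b} U" "C2-lipschitz_on {a..b} V" and N: "negligible N" and
    d: "\<And>x. x \<in> {a<..<b} - N \<Longrightarrow> (U has_vector_derivative V x / of_real (\<eta> x)) (at x)"
       "\<And>x. x \<in> {a<..<b} - N \<Longrightarrow> (V has_vector_derivative - (of_real \<omega>)\<^sup>2 * of_real (\<eta> x) * U x) (at x)"
    using assms unfolding system_solution_def by blast
  then have "C1-lipschitz_on {a..b} (\<lambda>x. cnj (U x))" "C2-lipschitz_on {a..b} (\<lambda>x. cnj (V x))"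
    by (auto simp: lipschitz_on_def dist_norm complex_cnj_diff[symmetric] simp del: complex_cnj_diff)
  moreover have "((\<lambda>x. cnj (U x)) has_vector_derivative cnj (V x) / of_real (\<eta> x)) (at x)"
     "((\<lambda>x. cnj (V x)) has_vector_derivative - (of_real \<omega>)\<^sup>2 * of_real (\<eta> x) * cnj (U x)) (at x)"
     if "x \<in> {a<..<b} - N" for x
    using has_vector_derivative_cnj[OF d(1)[OF that]]
      has_vector_derivative_cnj[OF d(2)[OF that]] by simp_all
  ultimately show ?thesis using N unfolding system_solution_def by blast
qed

text \<open>Off a null set the derivatives of \<open>U * Q\<close> and \<open>V * P\<close> are both
  \<open>V * Q / \<eta> - \<omega>^2 * \<eta> * U * P\<close>. The difference is Lipschitz, so the
  mean value inequality with slope 0 and bound 0 makes it constant.\<close>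

lemma system_solution_wronskian:
  assumes UV: "system_solution a b \<eta> \<omega> U V" and PQ: "system_solution a b \<eta> \<omega> P Q" and "a \<le> b"
  shows "U b * Q b - V b * P b = U a * Q a - V a * P a"
proof -
  obtain C1 C2 C3 C4 where lip: "C1-lipschitz_on {a..b} U" "C2-lipschitz_on {a..b} V"
     "C3-lipschitz_on {a..b} P" "C4-lipschitz_on {a..b} Q"
    using UV PQ unfolding system_solution_def by blast
  obtain N1 where N1: "negligible N1" and
    d1: "\<And>x. x \<in> {a<..<b} - N1 \<Longrightarrow> (U has_vector_derivative V x / of_real (\<eta> x)) (at x)"
       "\<And>x. x \<in> {a<..<b} - N1 \<Longrightarrow> (V has_vector_derivative - (of_real \<omega>)\<^sup>2 * of_real (\<eta> x) * U x) (at x)"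
    using UV unfolding system_solution_def by blast
  obtain N2 where N2: "negligible N2" and
    d2: "\<And>x. x \<in> {a<..<b} - N2 \<Longrightarrow> (P has_vector_derivative Q x / of_real (\<eta> x)) (at x)"
       "\<And>x. x \<in> {a<..<b} - N2 \<Longrightarrow> (Q has_vector_derivative - (of_real \<omega>)\<^sup>2 * of_real (\<eta> x) * P x) (at x)"
    using PQ unfolding system_solution_def by blast
  have mult: "\<exists>C. C-lipschitz_on {a..b} (\<lambda>x. f x * g x)"
    if f: "C-lipschitz_on {a..b} f" and g: "D-lipschitz_on {a..b} g" for f g :: "real \<Rightarrow> complex" and C D
  proof -
    have "bounded (f ` {a..b})" "bounded (g ` {a..b})"
      using f g by (auto intro!: compact_imp_bounded compact_continuous_image lipschitz_on_continuous_on)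
    then obtain A B where A: "\<And>x. x \<in> {a..b} \<Longrightarrow> norm (f x) \<le> A" and B: "\<And>x. x \<in> {a..b} \<Longrightarrow> norm (g x) \<le> B"
      unfolding bounded_iff by (meson imageI)
    have CD: "C \<ge> 0" "D \<ge> 0" using f g by (auto dest: lipschitz_on_nonneg)
    have AB: "A \<ge> 0" "B \<ge> 0" using A[of a] B[of a] \<open>a \<le> b\<close> by (auto intro: order_trans[OF norm_ge_zero])
    have "(A * D + B * C)-lipschitz_on {a..b} (\<lambda>x. f x * g x)"
    proof (rule lipschitz_onI)
      fix x y assume xy: "x \<in> {a..b}" "y \<in> {a..b}"
      have "f x * g x - f y * g y = f x * (g x - g y) + g y * (f x - f y)" by (simp add: algebra_simps)
      then have "dist (f x * g x) (f y * g y) \<le> norm (f x) * dist (g x) (g y) + norm (g y) * dist (f x) (f y)"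
        by (simp add: dist_norm) (metis norm_mult norm_triangle_ineq)
      also have "\<dots> \<le> A * (D * dist x y) + B * (C * dist x y)"
        using A[OF xy(1)] B[OF xy(2)] lipschitz_onD[OF f xy] lipschitz_onD[OF g xy] AB
        by (intro add_mono mult_mono) auto
      finally show "dist (f x * g x) (f y * g y) \<le> (A * D + B * C) * dist x y" by (simp add: algebra_simps)
    qed (use AB CD in simp)
    then show ?thesis ..
  qed
  define W where "W x = U x * Q x - V x * P x" for x
  obtain K1 K2 where "K1-lipschitz_on {a..b} (\<lambda>x. U x * Q x)" "K2-lipschitz_on {a..b} (\<lambda>x. V x * P x)"
    using mult[OF lip(1,4)] mult[OF lip(2,3)] by blast
  then have "(K1 + K2)-lipschitz_on {a..b} W"
    unfolding W_def by (rule lipschitz_on_diff)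
  then have ac: "abs_continuous_on {a..b} W" by (rule lipschitz_on_imp_abs_continuous_on)
  \<comment> \<open>The end points join the exceptional set because the equations are known only in
    the open interval.\<close>
  have N: "negligible (N1 \<union> N2 \<union> {a, b})" using N1 N2 by (intro negligible_Un) auto
  have "norm (W b - W a - (b - a) *\<^sub>R 0) \<le> 0 * (b - a)"
  proof (rule abs_continuous_on_norm_diff_le[OF ac order_refl \<open>a \<le> b\<close> N order_refl])
    fix t assume "t \<in> {a..b} - (N1 \<union> N2 \<union> {a, b})"
    then have t: "t \<in> {a<..<b} - N1" "t \<in> {a<..<b} - N2" by auto
    have "(W has_vector_derivative 0) (at t)"
      using has_vector_derivative_diff[OF has_vector_derivative_mult[OF d1(1)[OF t(1)] d2(2)[OF t(2)]]
          has_vector_derivative_mult[OF d1(2)[OF t(1)] d2(1)[OF t(2)]]]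
      by (simp add: W_def[abs_def] algebra_simps)
    then show "\<exists>D. (W has_vector_derivative D) (at t) \<and> norm (D - 0) \<le> 0" by auto
  qed
  then show ?thesis by (simp add: W_def)
qed

text \<open>A regulated function is, off a null set, continuous along the complement of that set.
  With one-sided limits at the end points of the interval, this is all the regularity used here.\<close>

definition regular_coeff :: "real \<Rightarrow> real \<Rightarrow> (real \<Rightarrow> real) \<Rightarrow> real set \<Rightarrow> real \<Rightarrow> real \<Rightarrow> bool" where
  "regular_coeff a b \<eta> G A B \<longleftrightarrow>
     a < b \<and> G \<subseteq> {a<..<b} \<and> negligible ({a<..<b} - G) \<and>
     (\<forall>x\<in>G. (\<eta> \<longlongrightarrow> \<eta> x) (at x within G)) \<and>
     (\<eta> \<longlongrightarrow> A) (at a within G) \<and> (\<eta> \<longlongrightarrow> B) (at b within G) \<and> A > 0 \<and> B > 0 \<and>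
     (\<exists>m M. m > 0 \<and> (\<forall>x\<in>G. m \<le> \<eta> x \<and> \<eta> x \<le> M))"

section \<open>Limits of solutions at the end points\<close>

lemma islimpt_end_of_ae_set:
  fixes a b :: real
  assumes "a < b" "negligible ({a<..<b} - S)" "S \<subseteq> {a<..<b}" "p = a \<or> p = b"
  shows "p islimpt S"
  unfolding islimpt_def
proof (intro allI impI)
  fix T assume "p \<in> T" "open T"
  then obtain e where e: "e > 0" "ball p e \<subseteq> T" using open_contains_ball by blast
  \<comment> \<open>\<open>I\<close> is a one-sided open neighbourhood of \<open>p\<close> within
    \<open>T\<close>; being nonempty and open it is not negligible, so it must meet
    \<open>S\<close>.\<close>
  define I where "I = (if p = a then {a<..<min b (a + e)} else {max a (b - e)<..<b})"
  have I: "I \<noteq> {}" "open I" "I \<subseteq> {a<..<b}" "I \<subseteq> T"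
    using e assms(1,4) by (auto simp: I_def dist_real_def subset_iff intro: dense)
  have "\<not> I \<subseteq> {a<..<b} - S"
    using I(1,2) assms(2) open_not_negligible negligible_subset by blast
  then obtain y where "y \<in> I" "y \<in> S" using I(3) by blast
  then show "\<exists>y\<in>S. y \<in> T \<and> y \<noteq> p" using I(4) assms by (intro bexI[of _ y]) auto
qed

text \<open>This makes the end limits in \<open>scattering_solution\<close> unique: \<open>u\<close>
  is differentiable almost everywhere, so its points of differentiability accumulate at both
  ends.\<close>

lemma end_filter_neq_bot:
  assumes "system_solution a b \<eta> \<omega> U V" "a < b" "\<And>x. x \<in> {a<..<b} \<Longrightarrow> u x = U x" "p = a \<or> p = b"
  shows "end_filter a b u p \<noteq> bot"
proof -
  obtain N where N: "negligible N" and
    d: "\<And>x. x \<in> {a<..<b} - N \<Longrightarrow> (U has_vector_derivative V x / of_real (\<eta> x)) (at x)"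
    using assms unfolding system_solution_def by blast
  have "u differentiable (at x)" if "x \<in> {a<..<b} - N" for x
  proof (rule differentiableI_vector)
    show "(u has_vector_derivative V x / of_real (\<eta> x)) (at x)"
      using has_vector_derivative_transform_within_open[OF d[OF that], of "{a<..<b}" u] assms(3) that by auto
  qed
  then have "negligible ({a<..<b} - {x \<in> {a<..<b}. u differentiable (at x)})"
    by (intro negligible_subset[OF N]) auto
  then have "p islimpt {x \<in> {a<..<b}. u differentiable (at x)}"
    using assms(2,4) by (intro islimpt_end_of_ae_set[of a b]) auto
  then show ?thesis by (simp add: end_filter_def trivial_limit_within)
qed

lemma system_solution_tendsto:
  assumes "system_solution a b \<eta> \<omega> U V" "p \<in> {a..b}" "S \<subseteq> {a..b}"
  shows "(U \<longlongrightarrow> U p) (at p within S)" "(V \<longlongrightarrow> V p) (at p within S)"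
proof -
  have "continuous_on {a..b} U" "continuous_on {a..b} V"
    using assms(1) unfolding system_solution_def by (blast intro: lipschitz_on_continuous_on)+
  then show "(U \<longlongrightarrow> U p) (at p within S)" "(V \<longlongrightarrow> V p) (at p within S)"
    using assms(2,3) by (auto simp: continuous_on_def intro: tendsto_within_subset)
qed

text \<open>The derivative of the solution is close to its boundary value only almost everywhere a priori,
  but by absolute continuity the difference quotients, and hence all existing derivatives, are close too.\<close>

lemma system_solution_derivative_at_end:
  assumes sol: "system_solution a b \<eta> \<omega> U V" and uU: "\<And>x. x \<in> {a<..<b} \<Longrightarrow> u x = U x"
    and G: "G \<subseteq> {a<..<b}" "negligible ({a<..<b} - G)"
    and p: "p = a \<or> p = b" and lim: "(\<eta> \<longlongrightarrow> A) (at p within G)" "A > 0" and "a < b"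
  shows "((\<lambda>x. vector_derivative u (at x)) \<longlongrightarrow> V p / of_real A) (end_filter a b u p)"
proof -
  define L where "L = V p / of_real A"
  obtain C N where lip: "C-lipschitz_on {a..b} U" and N: "negligible N" and
    d: "\<And>x. x \<in> {a<..<b} - N \<Longrightarrow> (U has_vector_derivative V x / of_real (\<eta> x)) (at x)"
    using sol unfolding system_solution_def by blast
  have ac: "abs_continuous_on {a..b} U" using lip by (rule lipschitz_on_imp_abs_continuous_on)
  have pab: "p \<in> {a..b}" using p \<open>a < b\<close> by auto
  have "(V \<longlongrightarrow> V p) (at p within G)" using system_solution_tendsto(2)[OF sol pab, of G] G(1) by force
  then have limL: "((\<lambda>x. V x / of_real (\<eta> x)) \<longlongrightarrow> L) (at p within G)"
    unfolding L_def using lim by (intro tendsto_intros) auto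
  show ?thesis
    unfolding end_filter_def L_def[symmetric]
  proof (rule tendstoI)
    fix e :: real assume "e > 0"
    then have "\<forall>\<^sub>F x in at p within G. dist (V x / of_real (\<eta> x)) L < e / 2"
      using limL by (intro tendstoD) auto
    then obtain \<delta> where \<delta>: "\<delta> > 0" and
      close: "\<And>x. x \<in> G \<Longrightarrow> x \<noteq> p \<Longrightarrow> dist x p < \<delta> \<Longrightarrow> dist (V x / of_real (\<eta> x)) L < e / 2"
      unfolding eventually_at by blast
    have "dist (vector_derivative u (at x)) L < e"
      if x: "x \<in> {a<..<b}" "dist x p < \<delta>" and diff: "u differentiable (at x)" for x
    proof -
      define D where "D = vector_derivative u (at x)"
      have "(u has_vector_derivative D) (at x)" using diff by (simp add: D_def vector_derivative_works)
      then have "(U has_vector_derivative D) (at x)"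
        using has_vector_derivative_transform_within_open[of u D x "{a<..<b}" U] uU x by auto
      then have "(U has_vector_derivative D) (at x within {x<..})"
        by (rule has_vector_derivative_at_within)
      then have quot: "((\<lambda>y. (1 / \<bar>y - x\<bar>) *\<^sub>R (U y - (U x + (y - x) *\<^sub>R D))) \<longlongrightarrow> 0) (at_right x)"
        by (simp add: has_vector_derivative_def has_derivative_within)
      \<comment> \<open>For \<open>y < z\<close> the whole segment from \<open>x\<close> to
        \<open>y\<close> stays in the interval and within \<delta> of \<open>p\<close>, where almost
        everywhere the derivative is \<open>e / 2\<close>-close to \<open>L\<close>. Letting
        \<open>y\<close> decrease to \<open>x\<close> then transfers the bound to the derivative at
        \<open>x\<close> itself.\<close>
      define z where "z = min b (x + (\<delta> - dist x p))"
      have z: "x < z" using x by (auto simp: z_def)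
      have bound: "norm (D - L) \<le> e / 2 + norm ((1 / \<bar>y - x\<bar>) *\<^sub>R (U y - (U x + (y - x) *\<^sub>R D)))"
        if y: "x < y" "y < z" for y
      proof -
        have yab: "y \<in> {a<..<b}" and near: "\<And>t. t \<in> {x..y} \<Longrightarrow> t \<in> {a<..<b} \<and> dist t p < \<delta>"
          using x y p by (auto simp: z_def dist_real_def)
        have "norm (U y - U x - (y - x) *\<^sub>R L) \<le> e / 2 * (y - x)"
        proof (rule abs_continuous_on_norm_diff_le[OF ac])
          show "{x..y} \<subseteq> {a..b}" using x yab by auto
          show "negligible (N \<union> ({a<..<b} - G))" using N G(2) by (rule negligible_Un)
          fix t assume t: "t \<in> {x..y} - (N \<union> ({a<..<b} - G))"
          then have "dist (V t / of_real (\<eta> t)) L < e / 2" using near[of t] p G(1) by (intro close) auto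
          then show "\<exists>D. (U has_vector_derivative D) (at t) \<and> norm (D - L) \<le> e / 2"
            using d[of t] t near[of t] by (intro exI[of _ "V t / of_real (\<eta> t)"]) (auto simp: dist_norm)
        qed (use y \<open>e > 0\<close> in auto)
        moreover define E where "E = U y - (U x + (y - x) *\<^sub>R D)"
        moreover define F where "F = D - L"
        moreover have "(y - x) *\<^sub>R F = (U y - U x - (y - x) *\<^sub>R L) - E"
          by (simp add: E_def F_def algebra_simps)
        ultimately have "norm ((y - x) *\<^sub>R F) \<le> e / 2 * (y - x) + norm E"
          using norm_triangle_ineq4 by (smt (verit))
        then have "(y - x) * norm F \<le> e / 2 * (y - x) + norm E" using y by simp
        then have "norm F \<le> e / 2 + norm E / (y - x)"
          using y by (simp add: field_simps)
        then show ?thesis using y by (simp add: E_def F_def)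
      qed
      have "norm (D - L) \<le> e / 2"
      proof (rule tendsto_lowerbound)
        show "((\<lambda>y. e / 2 + norm ((1 / \<bar>y - x\<bar>) *\<^sub>R (U y - (U x + (y - x) *\<^sub>R D)))) \<longlongrightarrow> e / 2) (at_right x)"
          using tendsto_add[OF tendsto_const[of "e/2"] tendsto_norm[OF quot]] by simp
        show "\<forall>\<^sub>F y in at_right x. norm (D - L) \<le> e / 2 + norm ((1 / \<bar>y - x\<bar>) *\<^sub>R (U y - (U x + (y - x) *\<^sub>R D)))"
          unfolding eventually_at_right_field using bound z by blast
      qed simp
      then show ?thesis using \<open>e > 0\<close> by (simp add: D_def dist_norm)
    qed
    then show "\<forall>\<^sub>F x in at p within {x \<in> {a<..<b}. u differentiable (at x)}. dist (vector_derivative u (at x)) L < e"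
      unfolding eventually_at using \<delta> by auto
  qed
qed

text \<open>The parts \<open>u\<^sup>\<ell>\<close> and \<open>u\<^sup>r\<close> at a point where \<open>u = U\<close>, \<open>\<eta>u' = V\<close> and \<open>\<eta>\<close> has one-sided limit \<open>A\<close>.\<close>

definition wave_left :: "real \<Rightarrow> real \<Rightarrow> complex \<Rightarrow> complex \<Rightarrow> complex" where
  "wave_left \<omega> A U V = 1/2 * (U - 1 / (\<i> * of_real \<omega>) * (V / of_real A))"

definition wave_right :: "real \<Rightarrow> real \<Rightarrow> complex \<Rightarrow> complex \<Rightarrow> complex" where
  "wave_right \<omega> A U V = 1/2 * (U + 1 / (\<i> * of_real \<omega>) * (V / of_real A))"

lemma system_solution_end_limits:
  assumes sol: "system_solution a b \<eta> \<omega> U V" and uU: "\<And>x. x \<in> {a<..<b} \<Longrightarrow> u x = U x"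
    and G: "G \<subseteq> {a<..<b}" "negligible ({a<..<b} - G)"
    and p: "p = a \<or> p = b" and lim: "(\<eta> \<longlongrightarrow> A) (at p within G)" "A > 0" and "a < b"
  shows "(left_part \<omega> u \<longlongrightarrow> wave_left \<omega> A (U p) (V p)) (end_filter a b u p)"
    and "(right_part \<omega> u \<longlongrightarrow> wave_right \<omega> A (U p) (V p)) (end_filter a b u p)"
proof -
  have "(U \<longlongrightarrow> U p) (end_filter a b u p)"
    unfolding end_filter_def using p \<open>a < b\<close> by (intro system_solution_tendsto[OF sol]) auto
  moreover have "\<forall>\<^sub>F x in end_filter a b u p. U x = u x"
    unfolding end_filter_def eventually_at using uU by (auto intro: exI[of _ 1])
  ultimately have "(u \<longlongrightarrow> U p) (end_filter a b u p)" by (rule Lim_transform_eventually)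
  note this system_solution_derivative_at_end[OF assms]
  then show "(left_part \<omega> u \<longlongrightarrow> wave_left \<omega> A (U p) (V p)) (end_filter a b u p)"
    and "(right_part \<omega> u \<longlongrightarrow> wave_right \<omega> A (U p) (V p)) (end_filter a b u p)"
    unfolding left_part_def right_part_def wave_left_def wave_right_def by (intro tendsto_intros; simp)+
qed

subsection \<open>Reflection coefficients in terms of system solutions\<close>

lemma wave_scale:
  "wave_left \<omega> A (c * U) (c * V) = c * wave_left \<omega> A U V"
  "wave_right \<omega> A (c * U) (c * V) = c * wave_right \<omega> A U V"
  by (simp_all add: wave_left_def wave_right_def algebra_simps)

lemma wave_inverse:
  assumes "\<omega> \<noteq> 0" "A \<noteq> 0"
  shows "U = wave_right \<omega> A U V + wave_left \<omega> A U V"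
    and "V = \<i> * of_real \<omega> * of_real A * (wave_right \<omega> A U V - wave_left \<omega> A U V)"
  using assms by (simp_all add: wave_left_def wave_right_def field_simps)

text \<open>In wave coordinates the Wronskian is, up to a nonzero factor, the determinant of the two
  pairs of left and right parts. It vanishes when both solutions have the same ratio of left to
  right part.\<close>

lemma wave_wronskian:
  assumes "\<omega> \<noteq> 0" "A \<noteq> 0"
  shows "U * Q - V * P = 2 * \<i> * of_real \<omega> * of_real A *
    (wave_left \<omega> A U V * wave_right \<omega> A P Q - wave_right \<omega> A U V * wave_left \<omega> A P Q)"
  using assms by (simp add: wave_left_def wave_right_def field_simps)

text \<open>The right-hand side is free of \<open>A\<close>. The weighted difference of squares is
  therefore the same on both sides of a jump of \<eta>, and it is propagated along the interval by
  the Wronskian with the conjugate solution.\<close>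

lemma wave_energy:
  assumes "\<omega> \<noteq> 0" "A \<noteq> 0"
  shows "A * ((norm (wave_right \<omega> A U V))\<^sup>2 - (norm (wave_left \<omega> A U V))\<^sup>2) = Im (cnj U * V) / \<omega>"
proof -
  define R L where "R = wave_right \<omega> A U V" and "L = wave_left \<omega> A U V"
  have "U = R + L" "V = \<i> * of_real \<omega> * of_real A * (R - L)"
    unfolding R_def L_def by (rule wave_inverse[OF assms])+
  then have "cnj U * V = \<i> * of_real \<omega> * of_real A * (cnj (R + L) * (R - L))"
    by (simp add: mult_ac)
  then have "Im (cnj U * V) = \<omega> * A * Re (cnj (R + L) * (R - L))" by simp
  also have "Re (cnj (R + L) * (R - L)) = (norm R)\<^sup>2 - (norm L)\<^sup>2"
    by (simp only: cmod_power2) (simp add: algebra_simps power2_eq_square)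
  finally show ?thesis using assms by (simp add: R_def L_def)
qed

lemma system_solution_energy:
  assumes "system_solution a b \<eta> \<omega> U V" "a \<le> b"
  shows "Im (cnj (U b) * V b) = Im (cnj (U a) * V a)"
proof -
  have "cnj (U b) * V b - cnj (V b) * U b = cnj (U a) * V a - cnj (V a) * U a"
    by (rule system_solution_wronskian[OF system_solution_cnj[OF assms(1)] assms])
  then show ?thesis by (simp add: complex_eq_iff algebra_simps)
qed

text \<open>Absolute continuity lets \<open>u\<close> and \<open>v\<close> extend continuously to
  the closed interval, so both are bounded. The equations then bound the derivatives almost
  everywhere, using the bounds of \<eta> on \<open>G\<close>, and the mean value inequality yields
  Lipschitz constants.\<close>

lemma scattering_imp_system_solution:
  assumes reg: "regular_coeff a b \<eta> G A B" and sc: "scattering_solution a b \<eta> \<omega> \<xi> u"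
  obtains U V where "system_solution a b \<eta> \<omega> U V" "\<And>x. x \<in> {a<..<b} \<Longrightarrow> u x = U x"
proof -
  obtain m M where ab: "a < b" and Gneg: "negligible ({a<..<b} - G)" and
    m: "m > 0" "\<And>x. x \<in> G \<Longrightarrow> m \<le> \<eta> x" "\<And>x. x \<in> G \<Longrightarrow> \<eta> x \<le> M"
    using reg unfolding regular_coeff_def by blast
  obtain v where ac: "abs_continuous_on {a<..<b} u" "abs_continuous_on {a<..<b} v" and
    "AE x in lebesgue_on {a<..<b}.
          u differentiable (at x) \<and> v x = of_real (\<eta> x) * vector_derivative u (at x) \<and>
          v differentiable (at x) \<and>
          vector_derivative v (at x) + (of_real \<omega>)\<^sup>2 * of_real (\<eta> x) * u x = 0"
    using sc unfolding scattering_solution_def by blast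
  then obtain N0 where N0: "negligible N0" and eqs: "\<And>x. x \<in> {a<..<b} - N0 \<Longrightarrow>
          u differentiable (at x) \<and> v x = of_real (\<eta> x) * vector_derivative u (at x) \<and>
          v differentiable (at x) \<and>
          vector_derivative v (at x) + (of_real \<omega>)\<^sup>2 * of_real (\<eta> x) * u x = 0"
    unfolding AE_lebesgue_on_interval_iff by blast
  define N where "N = N0 \<union> ({a<..<b} - G)"
  have N: "negligible N" unfolding N_def using N0 Gneg by (rule negligible_Un)
  have du: "(u has_vector_derivative v x / of_real (\<eta> x)) (at x)"
    and dv: "(v has_vector_derivative - (of_real \<omega>)\<^sup>2 * of_real (\<eta> x) * u x) (at x)"
    and \<eta>: "m \<le> \<eta> x" "\<eta> x \<le> M" if "x \<in> {a<..<b} - N" for x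
  proof -
    show *: "m \<le> \<eta> x" "\<eta> x \<le> M" using m that by (auto simp: N_def)
    have e: "u differentiable (at x)" "v x = of_real (\<eta> x) * vector_derivative u (at x)"
        "v differentiable (at x)"
        "vector_derivative v (at x) + (of_real \<omega>)\<^sup>2 * of_real (\<eta> x) * u x = 0"
      using eqs[of x] that by (auto simp: N_def)
    show "(u has_vector_derivative v x / of_real (\<eta> x)) (at x)"
      using e(1,2) * m(1) by (auto simp: vector_derivative_works)
    have "vector_derivative v (at x) = - (of_real \<omega>)\<^sup>2 * of_real (\<eta> x) * u x"
      using e(4) by (simp add: eq_neg_iff_add_eq_0)
    then show "(v has_vector_derivative - (of_real \<omega>)\<^sup>2 * of_real (\<eta> x) * u x) (at x)"
      using e(3) by (metis vector_derivative_works)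
  qed
  have cl: "closure {a<..<b} = {a..b}" using ab by simp
  have ext: "\<exists>F. continuous_on {a..b} F \<and> (\<forall>x\<in>{a<..<b}. f x = F x)"
    if "abs_continuous_on {a<..<b} f" for f
  proof -
    have "uniformly_continuous_on {a<..<b} f"
      using that by (rule abs_continuous_on_imp_uniformly_continuous_on) simp
    then obtain F where "uniformly_continuous_on (closure {a<..<b}) F" "\<And>x. x \<in> {a<..<b} \<Longrightarrow> f x = F x"
      using uniformly_continuous_on_extension_on_closure by metis
    then show ?thesis using uniformly_continuous_imp_continuous cl by metis
  qed
  obtain U where U: "continuous_on {a..b} U" "\<And>x. x \<in> {a<..<b} \<Longrightarrow> u x = U x" using ext[OF ac(1)] by blast
  obtain V where V: "continuous_on {a..b} V" "\<And>x. x \<in> {a<..<b} \<Longrightarrow> v x = V x" using ext[OF ac(2)] by blast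
  have "bounded (U ` {a..b})" "bounded (V ` {a..b})"
    using U(1) V(1) by (auto intro!: compact_imp_bounded compact_continuous_image)
  then obtain KU KV where K: "\<And>x. x \<in> {a..b} \<Longrightarrow> norm (U x) \<le> KU" "\<And>x. x \<in> {a..b} \<Longrightarrow> norm (V x) \<le> KV"
    unfolding bounded_iff by (meson imageI)
  have K0: "KU \<ge> 0" "KV \<ge> 0" using K[of a] ab by (auto intro: order_trans[OF norm_ge_zero])
  have lip: "\<exists>C. C-lipschitz_on {a..b} F"
    if f: "abs_continuous_on {a<..<b} f" "continuous_on {a..b} F" "\<And>x. x \<in> {a<..<b} \<Longrightarrow> f x = F x"
      and D: "\<And>x. x \<in> {a<..<b} - N \<Longrightarrow> (f has_vector_derivative D x) (at x) \<and> norm (D x) \<le> C" and "C \<ge> 0"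
    for f F D C
  proof -
    have le: "norm (f y - f x) \<le> C * (y - x)" if "x \<in> {a<..<b}" "y \<in> {a<..<b}" "x \<le> y" for x y
    proof -
      have "norm (f y - f x - (y - x) *\<^sub>R 0) \<le> C * (y - x)"
      proof (rule abs_continuous_on_norm_diff_le[OF f(1) _ that(3) N \<open>C \<ge> 0\<close>])
        show "\<exists>D. (f has_vector_derivative D) (at t) \<and> norm (D - 0) \<le> C" if "t \<in> {x..y} - N" for t
          using D[of t] that \<open>x \<in> {a<..<b}\<close> \<open>y \<in> {a<..<b}\<close> by auto
      qed (use that in auto)
      then show ?thesis by simp
    qed
    have "C-lipschitz_on {a<..<b} F"
    proof (rule lipschitz_onI[OF _ \<open>C \<ge> 0\<close>])
      fix x y assume "x \<in> {a<..<b}" "y \<in> {a<..<b}"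
      then show "dist (F x) (F y) \<le> C * dist x y"
        using le[of x y] le[of y x] f(3) by (cases "x \<le> y") (auto simp: dist_norm norm_minus_commute)
    qed
    then show ?thesis using lipschitz_on_closure[of C "{a<..<b}" F] f(2) cl by auto
  qed
  have "\<exists>C. C-lipschitz_on {a..b} U"
  proof (rule lip[OF ac(1) U])
    fix x assume x: "x \<in> {a<..<b} - N"
    then have "norm (v x / of_real (\<eta> x)) \<le> KV / m"
      using \<eta>[OF x] K(2)[of x] V(2)[of x] m(1) K0 by (auto simp: norm_divide intro!: frac_le)
    then show "(u has_vector_derivative v x / of_real (\<eta> x)) (at x) \<and> norm (v x / of_real (\<eta> x)) \<le> KV / m"
      using du[OF x] by simp
  qed (use m K0 in auto)
  moreover have "\<exists>C. C-lipschitz_on {a..b} V"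
  proof (rule lip[OF ac(2) V])
    fix x assume x: "x \<in> {a<..<b} - N"
    then have "norm (- (of_real \<omega>)\<^sup>2 * of_real (\<eta> x) * u x) \<le> \<omega>\<^sup>2 * \<bar>M\<bar> * KU"
      using \<eta>[OF x] K(1)[of x] U(2)[of x] m(1) K0
      by (auto simp: norm_mult norm_power intro!: mult_mono)
    then show "(v has_vector_derivative - (of_real \<omega>)\<^sup>2 * of_real (\<eta> x) * u x) (at x) \<and>
        norm (- (of_real \<omega>)\<^sup>2 * of_real (\<eta> x) * u x) \<le> \<omega>\<^sup>2 * \<bar>M\<bar> * KU"
      using dv[OF x] by simp
  qed (use K0 in auto)
  moreover have "(U has_vector_derivative V x / of_real (\<eta> x)) (at x)"
     "(V has_vector_derivative - (of_real \<omega>)\<^sup>2 * of_real (\<eta> x) * U x) (at x)" if x: "x \<in> {a<..<b} - N" for x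
    using has_vector_derivative_transform_within_open[OF du[OF x], of "{a<..<b}" U]
      has_vector_derivative_transform_within_open[OF dv[OF x], of "{a<..<b}" V] U(2) V(2) x by auto
  ultimately have "system_solution a b \<eta> \<omega> U V" using N unfolding system_solution_def by blast
  then show ?thesis using that U(2) by blast
qed

lemma system_imp_scattering_solution:
  assumes reg: "regular_coeff a b \<eta> G A B" and sol: "system_solution a b \<eta> \<omega> U V"
    and 1: "wave_right \<omega> A (U a) (V a) = 1"
    and \<xi>: "wave_left \<omega> B (U b) (V b) = \<xi> * wave_right \<omega> B (U b) (V b)"
  shows "scattering_solution a b \<eta> \<omega> \<xi> U"
    and "(left_part \<omega> U \<longlongrightarrow> wave_left \<omega> A (U a) (V a)) (end_filter a b U a)"
proof -
  obtain m M where ab: "a < b" and G: "G \<subseteq> {a<..<b}" "negligible ({a<..<b} - G)" and AB: "A > 0" "B > 0" and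
    lim: "(\<eta> \<longlongrightarrow> A) (at a within G)" "(\<eta> \<longlongrightarrow> B) (at b within G)" and
    m: "m > 0" "\<And>x. x \<in> G \<Longrightarrow> m \<le> \<eta> x"
    using reg unfolding regular_coeff_def by blast
  obtain C1 C2 N where lip: "C1-lipschitz_on {a..b} U" "C2-lipschitz_on {a..b} V" and N: "negligible N" and
    d: "\<And>x. x \<in> {a<..<b} - N \<Longrightarrow> (U has_vector_derivative V x / of_real (\<eta> x)) (at x)"
       "\<And>x. x \<in> {a<..<b} - N \<Longrightarrow> (V has_vector_derivative - (of_real \<omega>)\<^sup>2 * of_real (\<eta> x) * U x) (at x)"
    using sol unfolding system_solution_def by blast
  note la = system_solution_end_limits[OF sol refl G _ lim(1) AB(1) ab]
  note lb = system_solution_end_limits[OF sol refl G _ lim(2) AB(2) ab]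
  show "(left_part \<omega> U \<longlongrightarrow> wave_left \<omega> A (U a) (V a)) (end_filter a b U a)" using la by simp
  have ac: "abs_continuous_on {a<..<b} U" "abs_continuous_on {a<..<b} V"
    by (rule lipschitz_on_imp_abs_continuous_on[OF lipschitz_on_subset[OF lip(1)]], force)
      (rule lipschitz_on_imp_abs_continuous_on[OF lipschitz_on_subset[OF lip(2)]], force)
  have "AE x in lebesgue_on {a<..<b}.
          U differentiable (at x) \<and> V x = of_real (\<eta> x) * vector_derivative U (at x) \<and>
          V differentiable (at x) \<and>
          vector_derivative V (at x) + (of_real \<omega>)\<^sup>2 * of_real (\<eta> x) * U x = 0"
    unfolding AE_lebesgue_on_interval_iff
  proof (intro exI[of _ "N \<union> ({a<..<b} - G)"] conjI ballI)
    show "negligible (N \<union> ({a<..<b} - G))" using N G(2) by (rule negligible_Un)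
    fix x assume x: "x \<in> {a<..<b} - (N \<union> ({a<..<b} - G))"
    then have *: "x \<in> {a<..<b} - N" "x \<in> G" by auto
    show "U differentiable (at x)" "V differentiable (at x)" using d[OF *(1)] by (auto intro: differentiableI_vector)
    show "V x = of_real (\<eta> x) * vector_derivative U (at x)"
      using vector_derivative_at[OF d(1)[OF *(1)]] m(1) m(2)[OF *(2)] by simp
    show "vector_derivative V (at x) + (of_real \<omega>)\<^sup>2 * of_real (\<eta> x) * U x = 0"
      using vector_derivative_at[OF d(2)[OF *(1)]] by simp
  qed
  then show "scattering_solution a b \<eta> \<omega> \<xi> U"
    unfolding scattering_solution_def using ac la(2) lb 1 \<xi> by auto
qed

text \<open>The hypothesis allows any solution with left part smaller than right part at
  \<open>b\<close>, not only a normalised one, so that one solution can be restricted to both halves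
  of an interval.\<close>

lemma refl_coeff_eq:
  assumes reg: "regular_coeff a b \<eta> G A B" and sol: "system_solution a b \<eta> \<omega> U V" and "\<omega> \<noteq> 0"
    and \<xi>: "norm (wave_left \<omega> B (U b) (V b)) < norm (wave_right \<omega> B (U b) (V b))"
  shows "norm (wave_left \<omega> A (U a) (V a)) < norm (wave_right \<omega> A (U a) (V a))"
    and "refl_coeff a b \<eta> \<omega> (wave_left \<omega> B (U b) (V b) / wave_right \<omega> B (U b) (V b)) =
           wave_left \<omega> A (U a) (V a) / wave_right \<omega> A (U a) (V a)"
proof -
  obtain m M where ab: "a < b" and G: "G \<subseteq> {a<..<b}" "negligible ({a<..<b} - G)" and AB: "A > 0" "B > 0" and
    lim: "(\<eta> \<longlongrightarrow> A) (at a within G)" "(\<eta> \<longlongrightarrow> B) (at b within G)"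
    using reg unfolding regular_coeff_def by blast
  define La Ra Lb Rb where defs: "La = wave_left \<omega> A (U a) (V a)" "Ra = wave_right \<omega> A (U a) (V a)"
    "Lb = wave_left \<omega> B (U b) (V b)" "Rb = wave_right \<omega> B (U b) (V b)"
  have "A * ((norm Ra)\<^sup>2 - (norm La)\<^sup>2) = B * ((norm Rb)\<^sup>2 - (norm Lb)\<^sup>2)"
    using wave_energy[OF \<open>\<omega> \<noteq> 0\<close>, of A "U a" "V a"] wave_energy[OF \<open>\<omega> \<noteq> 0\<close>, of B "U b" "V b"]
      system_solution_energy[OF sol] ab AB by (simp add: defs)
  also have "\<dots> > 0" using \<xi> AB by (simp add: defs power_strict_mono)
  finally have "(norm La)\<^sup>2 < (norm Ra)\<^sup>2" using AB by (simp add: zero_less_mult_iff)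
  then show less: "norm La < norm Ra" by (rule power_less_imp_less_base) simp
  then have Ra: "Ra \<noteq> 0" by auto
  have Rb: "Rb \<noteq> 0" using \<xi> by (auto simp: defs)
  \<comment> \<open>Division by \<open>Ra\<close> enforces the normalisation of the right part at
    \<open>a\<close> and preserves the ratios.\<close>
  let ?U = "\<lambda>x. (1 / Ra) * U x" and ?V = "\<lambda>x. (1 / Ra) * V x"
  have sol': "system_solution a b \<eta> \<omega> ?U ?V" using sol by (rule system_solution_scale)
  show "refl_coeff a b \<eta> \<omega> (Lb / Rb) = La / Ra"
    unfolding refl_coeff_def
  proof (rule the_equality)
    have "wave_right \<omega> A (?U a) (?V a) = 1"
      "wave_left \<omega> B (?U b) (?V b) = Lb / Rb * wave_right \<omega> B (?U b) (?V b)"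
      "wave_left \<omega> A (?U a) (?V a) = La / Ra"
      using Ra Rb by (simp_all only: wave_scale defs[symmetric]) (simp_all add: field_simps)
    with system_imp_scattering_solution[OF reg sol', of "Lb / Rb"]
    show "\<exists>u. scattering_solution a b \<eta> \<omega> (Lb / Rb) u \<and> (left_part \<omega> u \<longlongrightarrow> La / Ra) (end_filter a b u a)"
      by (intro exI[of _ ?U]) auto
  next
    fix w assume "\<exists>u. scattering_solution a b \<eta> \<omega> (Lb / Rb) u \<and> (left_part \<omega> u \<longlongrightarrow> w) (end_filter a b u a)"
    then obtain u where sc: "scattering_solution a b \<eta> \<omega> (Lb / Rb) u"
      and w: "(left_part \<omega> u \<longlongrightarrow> w) (end_filter a b u a)" by blast
    obtain P Q where PQ: "system_solution a b \<eta> \<omega> P Q" "\<And>x. x \<in> {a<..<b} \<Longrightarrow> u x = P x"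
      using scattering_imp_system_solution[OF reg sc] by blast
    note la = system_solution_end_limits[OF PQ G _ lim(1) AB(1) ab]
    note lb = system_solution_end_limits[OF PQ G _ lim(2) AB(2) ab]
    have nb: "end_filter a b u a \<noteq> bot" "end_filter a b u b \<noteq> bot"
      using end_filter_neq_bot[OF PQ(1) ab PQ(2)] by auto
    obtain L R where LR: "(left_part \<omega> u \<longlongrightarrow> L) (end_filter a b u b)"
        "(right_part \<omega> u \<longlongrightarrow> R) (end_filter a b u b)" "L = Lb / Rb * R"
      and R1: "(right_part \<omega> u \<longlongrightarrow> 1) (end_filter a b u a)"
      using sc unfolding scattering_solution_def by blast
    have a: "wave_left \<omega> A (P a) (Q a) = w" "wave_right \<omega> A (P a) (Q a) = 1"
      using tendsto_unique[OF nb(1) _ w] tendsto_unique[OF nb(1) _ R1] la by auto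
    have b: "wave_left \<omega> B (P b) (Q b) = L" "wave_right \<omega> B (P b) (Q b) = R"
      using tendsto_unique[OF nb(2) _ LR(1)] tendsto_unique[OF nb(2) _ LR(2)] lb by auto
    \<comment> \<open>Both solutions have ratio \<open>Lb / Rb\<close> at \<open>b\<close>, so their
      Wronskian vanishes there and hence at \<open>a\<close>, where it expresses
      \<open>w = La / Ra\<close>.\<close>
    have "U b * Q b - V b * P b = U a * Q a - V a * P a"
      using ab by (intro system_solution_wronskian[OF sol PQ(1)]) simp
    moreover have "U b * Q b - V b * P b = 0"
      using wave_wronskian[OF \<open>\<omega> \<noteq> 0\<close>, of B "U b" "Q b" "V b" "P b"] AB Rb LR(3)
      by (simp add: b defs[symmetric] field_simps)
    moreover have "U a * Q a - V a * P a = 2 * \<i> * of_real \<omega> * of_real A * (La - Ra * w)"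
      using wave_wronskian[OF \<open>\<omega> \<noteq> 0\<close>, of A "U a" "Q a" "V a" "P a"] AB by (simp add: a defs[symmetric])
    ultimately show "w = La / Ra" using Ra AB \<open>\<omega> \<noteq> 0\<close> by (simp add: field_simps)
  qed
qed

subsection \<open>Existence of solutions\<close>

lemma integral_exp_weight:
  fixes l :: real
  assumes "l > 0" "x \<le> b"
  shows "((\<lambda>t. exp (l * (b - t))) has_integral (exp (l * (b - x)) - 1) / l) {x..b}"
proof -
  have "((\<lambda>t. exp (l * (b - t))) has_integral (- exp (l * (b - b)) / l) - (- exp (l * (b - x)) / l)) {x..b}"
    using assms by (intro fundamental_theorem_of_calculus)
      (auto intro!: derivative_eq_intros simp flip: has_real_derivative_iff_has_vector_derivative)
  then show ?thesis by (simp add: diff_divide_distrib)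
qed

text \<open>With the weight \<open>exp (l * (b - t))\<close> the Volterra operator becomes a contraction on the whole
  interval.\<close>

lemma volterra_solution_exists:
  fixes K :: "real \<Rightarrow> 'b::euclidean_space \<Rightarrow> 'b"
  assumes "a \<le> b" and "C \<ge> 0"
    and lip: "\<And>t x y. norm (K t x - K t y) \<le> C * norm (x - y)"
    and int: "\<And>y. continuous_on {a..b} y \<Longrightarrow> (\<lambda>t. K t (y t)) integrable_on {a..b}"
  shows "\<exists>y. continuous_on {a..b} y \<and> (\<forall>x\<in>{a..b}. y x = y0 - integral {x..b} (\<lambda>t. K t (y t)))"
proof -
  \<comment> \<open>This choice gives contraction constant \<open>C / l \<le> 1/2\<close>; the
    summand 1 keeps \<open>l\<close> positive when \<open>C = 0\<close>.\<close>
  define l where "l = 2 * C + 1"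
  have l: "l > 0" "C / l \<le> 1/2" using \<open>C \<ge> 0\<close> by (auto simp: l_def field_simps)
  define e where "e t = exp (l * (b - t))" for t
  have e0: "e t > 0" for t by (simp add: e_def)
  have econt: "continuous_on S e" for S unfolding e_def by (intro continuous_intros)
  \<comment> \<open>The unknown is \<open>z = y / e\<close>, so that the weighted supremum norm of
    \<open>y\<close> is the ordinary supremum norm of \<open>z\<close>.\<close>
  define T where "T z x = (1 / e x) *\<^sub>R (y0 - integral {x..b} (\<lambda>t. K t (e t *\<^sub>R z t)))" for z :: "real \<Rightarrow> 'b" and x
  have intz: "(\<lambda>t. K t (e t *\<^sub>R z t)) integrable_on {a..b}" if "continuous_on {a..b} z" for z :: "real \<Rightarrow> 'b"
    by (intro int continuous_intros econt that)
  have Tcont: "continuous_on (cbox a b) (T z)" if "continuous_on {a..b} z" for z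
  proof -
    have "continuous_on {a..b} (T z)"
      unfolding T_def
      by (intro continuous_intros indefinite_integral_continuous_1' intz econt that) (use e0 in \<open>force simp: less_le\<close>)
    then show ?thesis by simp
  qed
  \<comment> \<open>Composition with \<open>clamp\<close> extends \<open>T z\<close> from the
    interval to the whole line, which makes it an element of the Banach space of bounded continuous
    functions.\<close>
  have "\<exists>\<Phi>. \<forall>z::real \<Rightarrow>\<^sub>C 'b. \<forall>x. apply_bcontfun (\<Phi> z) x = T (apply_bcontfun z) (clamp a b x)"
    by (rule choice, rule allI) (metis continuous_on_cbox_bcontfunE[OF Tcont[OF continuous_on_apply_bcontfun]])
  then obtain \<Phi> :: "(real \<Rightarrow>\<^sub>C 'b) \<Rightarrow> (real \<Rightarrow>\<^sub>C 'b)"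
    where \<Phi>: "\<And>z x. apply_bcontfun (\<Phi> z) x = T (apply_bcontfun z) (clamp a b x)" by blast
  have contr: "norm (T (apply_bcontfun z) x - T (apply_bcontfun w) x) \<le> 1/2 * dist z w" if x: "x \<in> {a..b}" for z w x
  proof -
    have sub: "{x..b} \<subseteq> {a..b}" using x by auto
    have ii: "(\<lambda>t. K t (e t *\<^sub>R apply_bcontfun z t)) integrable_on {x..b}" for z :: "real \<Rightarrow>\<^sub>C 'b"
      by (rule integrable_on_subinterval[OF intz sub]) simp
    have "T (apply_bcontfun z) x - T (apply_bcontfun w) x =
        (1 / e x) *\<^sub>R integral {x..b} (\<lambda>t. K t (e t *\<^sub>R apply_bcontfun w t) - K t (e t *\<^sub>R apply_bcontfun z t))"
      unfolding T_def integral_diff[OF ii ii] by (simp add: algebra_simps)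
    moreover have "norm (integral {x..b} (\<lambda>t. K t (e t *\<^sub>R apply_bcontfun w t) - K t (e t *\<^sub>R apply_bcontfun z t)))
        \<le> integral {x..b} (\<lambda>t. C * dist z w * e t)"
    proof (rule integral_norm_bound_integral)
      show "(\<lambda>t. K t (e t *\<^sub>R apply_bcontfun w t) - K t (e t *\<^sub>R apply_bcontfun z t)) integrable_on {x..b}"
        by (intro integrable_diff ii)
      show "(\<lambda>t. C * dist z w * e t) integrable_on {x..b}"
        by (intro integrable_continuous_real continuous_intros econt)
      fix t assume "t \<in> {x..b}"
      have "norm (K t (e t *\<^sub>R apply_bcontfun w t) - K t (e t *\<^sub>R apply_bcontfun z t))
          \<le> C * norm (e t *\<^sub>R (apply_bcontfun w t - apply_bcontfun z t))"
        using lip[of t "e t *\<^sub>R apply_bcontfun w t" "e t *\<^sub>R apply_bcontfun z t"] by (simp add: scaleR_diff_right)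
      also have "\<dots> = C * (e t * dist (apply_bcontfun w t) (apply_bcontfun z t))"
        using e0[of t] by (simp add: dist_norm)
      also have "\<dots> \<le> C * (e t * dist w z)"
        using e0[of t] \<open>C \<ge> 0\<close> by (intro mult_left_mono dist_bounded) auto
      finally show "norm (K t (e t *\<^sub>R apply_bcontfun w t) - K t (e t *\<^sub>R apply_bcontfun z t)) \<le> C * dist z w * e t"
        by (simp add: mult_ac dist_commute)
    qed
    moreover have "integral {x..b} (\<lambda>t. C * dist z w * e t) = C * dist z w * ((e x - 1) / l)"
      using integral_exp_weight[OF l(1), of x b] x unfolding e_def
      by (simp add: integral_unique)
    ultimately have "norm (T (apply_bcontfun z) x - T (apply_bcontfun w) x) \<le> (1 / e x) * (C * dist z w * ((e x - 1) / l))"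
      using e0[of x] by (simp only: norm_scaleR) (intro mult_mono; simp)
    also have "\<dots> = (C / l) * dist z w * ((e x - 1) / e x)" by simp
    also have "\<dots> \<le> (C / l) * dist z w * 1"
      using e0[of x] l \<open>C \<ge> 0\<close> by (intro mult_left_mono) auto
    also have "\<dots> \<le> 1/2 * dist z w" using mult_right_mono[OF l(2) zero_le_dist, of z w] by simp
    finally show ?thesis .
  qed
  have cl: "clamp a b x \<in> {a..b}" for x using clamp_in_interval[of a b x] \<open>a \<le> b\<close> by simp
  have "\<exists>!z. \<Phi> z = z"
  proof (rule banach_fix_type[of "1/2"], simp, simp, intro allI)
    fix z w show "dist (\<Phi> z) (\<Phi> w) \<le> 1/2 * dist z w"
      by (rule dist_bound) (use contr cl in \<open>simp add: \<Phi> dist_norm\<close>)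
  qed
  then obtain z where z: "\<Phi> z = z" by blast
  define y where "y t = e t *\<^sub>R apply_bcontfun z t" for t
  show ?thesis
  proof (intro exI[of _ y] conjI ballI)
    show "continuous_on {a..b} y" unfolding y_def by (intro continuous_intros econt) simp
    fix x assume x: "x \<in> {a..b}"
    then have "clamp a b x = x" using clamp_cancel_cbox[of x a b] by simp
    then have "apply_bcontfun z x = T (apply_bcontfun z) x" using \<Phi>[of z x] z by simp
    then show "y x = y0 - integral {x..b} (\<lambda>t. K t (y t))"
      using e0[of x] by (simp add: y_def T_def)
  qed
qed

text \<open>The system is linear with coefficients bounded on \<open>G\<close>, which gives the
  global Lipschitz condition of the Volterra equation. Continuity of \<eta> along \<open>G\<close>
  then makes the integral differentiable at each point of \<open>G\<close>.\<close>

lemma system_solution_exists: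
  assumes reg: "regular_coeff a b \<eta> G A B"
  obtains U V where "system_solution a b \<eta> \<omega> U V" "U b = p" "V b = q"
proof -
  obtain m M where ab: "a < b" and G: "G \<subseteq> {a<..<b}" "negligible ({a<..<b} - G)" and
    lim: "\<And>x. x \<in> G \<Longrightarrow> (\<eta> \<longlongrightarrow> \<eta> x) (at x within G)" and
    m: "m > 0" "\<And>x. x \<in> G \<Longrightarrow> m \<le> \<eta> x" "\<And>x. x \<in> G \<Longrightarrow> \<eta> x \<le> M"
    using reg unfolding regular_coeff_def by blast
  have \<eta>cont: "continuous_on G \<eta>" using lim by (simp add: continuous_on_def)
  have \<eta>pos: "\<eta> x > 0" if "x \<in> G" for x using m that by (auto intro: less_le_trans)
  define N where "N = {a..b} - G"
  have N: "negligible N"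
  proof -
    have "N \<subseteq> ({a<..<b} - G) \<union> {a, b}" by (auto simp: N_def)
    then show ?thesis using G(2) by (meson negligible_Un negligible_subset negligible_finite finite.intros)
  qed
  have Geq: "G = {a..b} - N" using G(1) by (auto simp: N_def)
  have Gmeas: "G \<in> lmeasurable"
    unfolding Geq using N by (intro fmeasurable.Diff) (auto intro: negligible_imp_measurable)
  \<comment> \<open>Cutting off outside \<open>G\<close> makes the bound by \<open>C\<close> valid
    for all \<open>t\<close>; only a null set is affected.\<close>
  define K where "K t z = (if t \<in> G then ((1 / \<eta> t) *\<^sub>R snd z, (- \<omega>\<^sup>2 * \<eta> t) *\<^sub>R fst z) else 0)"
    for t and z :: "complex \<times> complex"
  define C where "C = 1 / m + \<omega>\<^sup>2 * \<bar>M\<bar>"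
  have C: "C \<ge> 0" using m(1) by (simp add: C_def)
  have Kle: "norm (K t z) \<le> C * norm z" for t z
  proof (cases "t \<in> G")
    case True
    have "norm (K t z) \<le> norm ((1 / \<eta> t) *\<^sub>R snd z) + norm ((- \<omega>\<^sup>2 * \<eta> t) *\<^sub>R fst z)"
      using True norm_Pair_le[of "(1 / \<eta> t) *\<^sub>R snd z" "(- \<omega>\<^sup>2 * \<eta> t) *\<^sub>R fst z"] by (simp only: K_def if_True)
    also have "\<dots> = 1 / \<eta> t * norm (snd z) + \<omega>\<^sup>2 * \<eta> t * norm (fst z)"
      using \<eta>pos[OF True] by (simp add: abs_mult)
    also have "\<dots> \<le> 1 / m * norm z + \<omega>\<^sup>2 * \<bar>M\<bar> * norm z"
      using m(1) m(2,3)[OF True] norm_fst_le[of "fst z" "snd z"] norm_snd_le[of "snd z" "fst z"]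
      by (intro add_mono mult_mono) (auto intro!: frac_le mult_left_mono)
    finally show ?thesis by (simp add: C_def algebra_simps)
  next
    case False
    then show ?thesis using C by (simp add: K_def)
  qed
  have Klip: "norm (K t z - K t w) \<le> C * norm (z - w)" for t z w
  proof -
    have "K t z - K t w = K t (z - w)" by (simp add: K_def scaleR_diff_right)
    then show ?thesis using Kle[of t "z - w"] by simp
  qed
  \<comment> \<open>\<open>h y\<close> is the right-hand side without the cutoff: continuous on
    \<open>G\<close>, hence measurable there.\<close>
  define h where "h y t = ((1 / \<eta> t) *\<^sub>R snd (y t), (- \<omega>\<^sup>2 * \<eta> t) *\<^sub>R fst (y t))"
    for y :: "real \<Rightarrow> complex \<times> complex" and t
  have hcont: "continuous_on G (h y)" if "continuous_on {a..b} y" for y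
  proof -
    have "continuous_on G y" using that continuous_on_subset Geq by blast
    then show ?thesis unfolding h_def using \<eta>pos by (intro continuous_intros \<eta>cont) force+
  qed
  have bdd: "\<exists>D. \<forall>t\<in>{a..b}. norm (K t (y t)) \<le> D" if y: "continuous_on {a..b} y" for y
  proof -
    have "bounded (y ` {a..b})" using y by (intro compact_imp_bounded compact_continuous_image) auto
    then obtain D where "\<And>t. t \<in> {a..b} \<Longrightarrow> norm (y t) \<le> D" unfolding bounded_iff by blast
    then show ?thesis using Kle C by (intro exI[of _ "C * D"] ballI) (meson mult_left_mono order_trans)
  qed
  have int: "(\<lambda>t. K t (y t)) integrable_on {a..b}" if y: "continuous_on {a..b} y" for y
  proof -
    obtain D where D: "\<And>t. t \<in> {a..b} \<Longrightarrow> norm (K t (y t)) \<le> D" using bdd[OF y] by blast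
    have "h y absolutely_integrable_on G"
    proof (rule measurable_bounded_by_integrable_imp_absolutely_integrable)
      show "h y \<in> borel_measurable (lebesgue_on G)"
        using hcont[OF y] Gmeas by (intro continuous_imp_measurable_on_sets_lebesgue) auto
      show "(\<lambda>t. D) integrable_on G" using Gmeas by (rule integrable_on_const)
      show "norm (h y x) \<le> D" if "x \<in> G" for x using D[of x] that Geq by (auto simp: h_def K_def)
    qed (use Gmeas in auto)
    then have "(\<lambda>t. K t (y t)) integrable_on G"
      using integrable_eq[of "h y" G "\<lambda>t. K t (y t)"] by (auto simp: h_def K_def absolutely_integrable_on_def)
    then show ?thesis
      by (rule integrable_spike_set) (auto intro: negligible_subset[OF N] simp: Geq)
  qed
  obtain y where y: "continuous_on {a..b} y" and
    yeq: "\<And>x. x \<in> {a..b} \<Longrightarrow> y x = (p, q) - integral {x..b} (\<lambda>t. K t (y t))"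
    using volterra_solution_exists[OF less_imp_le[OF ab] C Klip int, of "(p, q)"] by blast
  define f where "f t = K t (y t)" for t
  have fint: "f integrable_on {a..b}" using int[OF y] by (simp add: f_def[abs_def])
  have diff: "y x' - y x = integral {x..x'} f" if "x \<in> {a..b}" "x' \<in> {a..b}" "x \<le> x'" for x x'
  proof -
    have "integral {x..x'} f + integral {x'..b} f = integral {x..b} f"
      using that by (intro Henstock_Kurzweil_Integration.integral_combine integrable_on_subinterval[OF fint]) auto
    moreover have "y x = (p, q) - integral {x..b} f" "y x' = (p, q) - integral {x'..b} f"
      using yeq that by (simp_all add: f_def[abs_def])
    ultimately show ?thesis by (simp add: diff_eq_eq)
  qed
  obtain D where D: "\<And>t. t \<in> {a..b} \<Longrightarrow> norm (f t) \<le> D" using bdd[OF y] unfolding f_def by blast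
  have D0: "D \<ge> 0" using D[of a] ab by (auto intro: order_trans[OF norm_ge_zero])
  have le: "norm (y x' - y x) \<le> D * (x' - x)" if "x \<in> {a..b}" "x' \<in> {a..b}" "x \<le> x'" for x x'
  proof -
    have "f integrable_on cbox x x'"
      using that by (auto intro: integrable_on_subinterval[OF fint])
    from has_integral_bound[OF D0 integrable_integral[OF this]]
    have "norm (integral {x..x'} f) \<le> D * measure lborel (cbox x x')"
      using that D by auto
    then show ?thesis using that by (simp add: diff)
  qed
  have ylip: "D-lipschitz_on {a..b} y"
  proof (rule lipschitz_onI[OF _ D0])
    fix x x' assume "x \<in> {a..b}" "x' \<in> {a..b}"
    then show "dist (y x) (y x') \<le> D * dist x x'"
      using le[of x x'] le[of x' x] by (cases "x \<le> x'") (auto simp: dist_norm norm_minus_commute)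
  qed
  have yd: "(y has_vector_derivative h y x) (at x)" if x: "x \<in> G" for x
  proof -
    \<comment> \<open>Off \<open>G\<close> the integrand is replaced by its value at
      \<open>x\<close>. This changes no integral and makes it continuous at \<open>x\<close> within
      the full interval, as the fundamental theorem of calculus demands.\<close>
    define g where "g t = (if t \<in> G then h y t else h y x)" for t
    have xab: "x \<in> {a<..<b}" using x G(1) by auto
    have gf: "g t = f t" if "t \<in> {a..b} - N" for t
      using that by (auto simp: Geq[symmetric] g_def f_def K_def h_def)
    have gint: "g integrable_on {a..b}" using integrable_spike[OF fint N gf] .
    have "(g \<longlongrightarrow> h y x) (at x within {a..b})"
    proof (rule tendstoI)
      fix e :: real assume "e > 0"
      have "(h y \<longlongrightarrow> h y x) (at x within G)" using hcont[OF y] x by (simp add: continuous_on_def)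
      then have "\<forall>\<^sub>F t in at x within G. dist (h y t) (h y x) < e" using \<open>e > 0\<close> by (rule tendstoD)
      then show "\<forall>\<^sub>F t in at x within {a..b}. dist (g t) (h y x) < e"
        unfolding eventually_at using \<open>e > 0\<close> by (auto simp: g_def)
    qed
    then have "continuous (at x within {a..b} - {}) g" using x by (simp add: continuous_within g_def)
    then have "((\<lambda>u. integral {a..u} g) has_vector_derivative g x) (at x within {a..b} - {})"
      using xab by (intro integral_has_vector_derivative_continuous_at[OF gint]) auto
    then have "((\<lambda>u. y a + integral {a..u} g) has_vector_derivative h y x) (at x within {a<..<b})"
      using x by (auto intro!: derivative_eq_intros elim!: has_vector_derivative_within_subset simp: g_def)
    then have "((\<lambda>u. y a + integral {a..u} g) has_vector_derivative h y x) (at x)"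
      using xab by (metis at_within_open open_greaterThanLessThan)
    then show ?thesis
    proof (rule has_vector_derivative_transform_within_open[OF _ _ xab])
      fix u assume u: "u \<in> {a<..<b}"
      have "integral {a..u} g = integral {a..u} f"
        using u by (intro integral_spike[OF N]) (auto simp: gf)
      then show "y a + integral {a..u} g = y u" using diff[of a u] u by (simp add: algebra_simps)
    qed simp
  qed
  have "system_solution a b \<eta> \<omega> (\<lambda>t. fst (y t)) (\<lambda>t. snd (y t))"
    unfolding system_solution_def
  proof (intro conjI exI ballI)
    show "D-lipschitz_on {a..b} (\<lambda>t. fst (y t))" "D-lipschitz_on {a..b} (\<lambda>t. snd (y t))"
      using ylip dist_fst_le dist_snd_le unfolding lipschitz_on_def by (meson order_trans)+
    show "negligible N" by (rule N)
    fix x assume "x \<in> {a<..<b} - N"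
    then have "x \<in> G" by (auto simp: N_def)
    from bounded_linear.has_vector_derivative[OF bounded_linear_fst yd[OF this]]
      bounded_linear.has_vector_derivative[OF bounded_linear_snd yd[OF this]]
    show "((\<lambda>t. fst (y t)) has_vector_derivative snd (y x) / of_real (\<eta> x)) (at x)"
      "((\<lambda>t. snd (y t)) has_vector_derivative - (of_real \<omega>)\<^sup>2 * of_real (\<eta> x) * fst (y x)) (at x)"
      by (simp_all add: h_def scaleR_conv_of_real mult_ac divide_inverse)
  qed
  moreover have "y b = (p, q)" using yeq[of b] ab by simp
  ultimately show ?thesis using that by simp
qed

subsection \<open>Composition of reflection coefficients\<close>

text \<open>\<open>U\<close> and \<open>V\<close> are common to both sides and only the impedance
  changes. The energy is independent of it, which gives the inequality, and eliminating
  \<open>U\<close> and \<open>V\<close> gives a linear relation between the two pairs of waves, that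
  is, a Moebius map of the ratios.\<close>

lemma wave_transmission:
  assumes "\<omega> \<noteq> 0" "C1 > 0" "C2 > 0"
  defines "\<rho> \<equiv> (C1 - C2) / (C1 + C2)"
  assumes less: "norm (wave_left \<omega> C2 U V) < norm (wave_right \<omega> C2 U V)"
  shows "norm (wave_left \<omega> C1 U V) < norm (wave_right \<omega> C1 U V)"
    and "disk_auto 1 (of_real \<rho>) (wave_left \<omega> C2 U V / wave_right \<omega> C2 U V) =
         wave_left \<omega> C1 U V / wave_right \<omega> C1 U V"
proof -
  define L1 R1 L2 R2 where defs: "L1 = wave_left \<omega> C1 U V" "R1 = wave_right \<omega> C1 U V"
    "L2 = wave_left \<omega> C2 U V" "R2 = wave_right \<omega> C2 U V"
  have "C1 * ((norm R1)\<^sup>2 - (norm L1)\<^sup>2) = C2 * ((norm R2)\<^sup>2 - (norm L2)\<^sup>2)"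
    using wave_energy[OF \<open>\<omega> \<noteq> 0\<close>, of C1 U V] wave_energy[OF \<open>\<omega> \<noteq> 0\<close>, of C2 U V] assms(2,3)
    by (simp add: defs)
  also have "\<dots> > 0" using less assms(3) by (simp add: defs power_strict_mono)
  finally have "(norm L1)\<^sup>2 < (norm R1)\<^sup>2" using assms(2) by (simp add: zero_less_mult_iff)
  then show less1: "norm L1 < norm R1" by (rule power_less_imp_less_base) simp
  then have R1: "R1 \<noteq> 0" by auto
  have R2: "R2 \<noteq> 0" using less by (auto simp: defs)
  have UV: "U = R2 + L2" "V = \<i> * of_real \<omega> * of_real C2 * (R2 - L2)"
    unfolding defs using assms by (auto intro!: wave_inverse)
  define s d where "s = complex_of_real (C1 + C2)" and "d = complex_of_real (C1 - C2)"
  have L1eq: "2 * of_real C1 * L1 = d * R2 + s * L2"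
    and R1eq: "2 * of_real C1 * R1 = s * R2 + d * L2"
    using assms(1-3) unfolding defs(1,2) wave_left_def wave_right_def UV
    by (simp_all add: field_simps s_def d_def)
  have s: "s \<noteq> 0" using assms(2,3) by (simp add: s_def del: of_real_add)
  have \<rho>: "of_real \<rho> = d / s" by (simp add: \<rho>_def s_def d_def)
  \<comment> \<open>The parameter is real, so the conjugate in \<open>disk_auto\<close> disappears
    and both fractions share the denominator \<open>s * R2\<close>.\<close>
  have "cnj (d / s) = d / s" by (simp add: s_def d_def)
  then have num: "L2 / R2 + of_real \<rho> = 2 * of_real C1 * L1 / (s * R2)"
    and den: "1 + cnj (of_real \<rho>) * (L2 / R2) = 2 * of_real C1 * R1 / (s * R2)"
    unfolding L1eq R1eq \<rho> using s R2 by (simp_all add: field_simps)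
  show "disk_auto 1 (of_real \<rho>) (L2 / R2) = L1 / R1"
    unfolding disk_auto_def num den using s R1 R2 assms(2) by (simp add: field_simps)
qed

lemma disk_comp_eq:
  assumes "g z \<in> ball 0 1"
  shows "(f \<circ>\<^sub>D g) z = f (g z)"
  using assms by (simp add: disk_comp_def disk_ext_def)

text \<open>One solution on the whole interval is restricted to both parts, with \<open>B1\<close>
  and \<open>B2\<close> the limits of \<eta> at \<open>b\<close> from the left and the right. Equal
  limits give \<open>disk_auto 1 0\<close>, the identity, so both claims of the theorem are
  instances.\<close>

lemma refl_coeff_composition:
  assumes "regular_coeff a c \<eta> G A C" "regular_coeff a b \<eta> G1 A B1" "regular_coeff b c \<eta> G2 B2 C"
    and "\<omega> \<noteq> 0" and \<xi>: "\<xi> \<in> ball 0 1"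
  shows "refl_coeff b c \<eta> \<omega> \<xi> \<in> ball 0 1"
    and "disk_auto 1 (of_real ((B1 - B2) / (B1 + B2))) (refl_coeff b c \<eta> \<omega> \<xi>) \<in> ball 0 1"
    and "refl_coeff a c \<eta> \<omega> \<xi> =
      refl_coeff a b \<eta> \<omega> (disk_auto 1 (of_real ((B1 - B2) / (B1 + B2))) (refl_coeff b c \<eta> \<omega> \<xi>))"
proof -
  have pos: "B1 > 0" "B2 > 0" "C > 0" and "a < b" "b < c"
    using assms(2,3) by (auto simp: regular_coeff_def)
  \<comment> \<open>These data make the waves at \<open>c\<close> equal to \<xi> (left) and 1
    (right).\<close>
  obtain U V where sol: "system_solution a c \<eta> \<omega> U V" and
    UV: "U c = 1 + \<xi>" "V c = \<i> * of_real \<omega> * of_real C * (1 - \<xi>)"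
    using system_solution_exists[OF assms(1)] by metis
  have c: "wave_left \<omega> C (U c) (V c) = \<xi>" "wave_right \<omega> C (U c) (V c) = 1"
    using UV \<open>\<omega> \<noteq> 0\<close> pos by (simp_all add: wave_left_def wave_right_def field_simps)
  then have lessc: "norm (wave_left \<omega> C (U c) (V c)) < norm (wave_right \<omega> C (U c) (V c))" using \<xi> by simp
  have sols: "system_solution a b \<eta> \<omega> U V" "system_solution b c \<eta> \<omega> U V"
    using \<open>a < b\<close> \<open>b < c\<close> by (auto intro: system_solution_subinterval[OF sol])
  have ball: "L / R \<in> ball 0 1" if "norm L < norm R" for L R :: complex
    using that by (cases "R = 0") (auto simp: norm_divide field_simps)
  note 2 = refl_coeff_eq[OF assms(3) sols(2) \<open>\<omega> \<noteq> 0\<close> lessc]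
  note t = wave_transmission[OF \<open>\<omega> \<noteq> 0\<close> pos(1,2) 2(1)]
  note 1 = refl_coeff_eq[OF assms(2) sols(1) \<open>\<omega> \<noteq> 0\<close> t(1)]
  note 0 = refl_coeff_eq[OF assms(1) sol \<open>\<omega> \<noteq> 0\<close> lessc]
  have eq2: "refl_coeff b c \<eta> \<omega> \<xi> = wave_left \<omega> B2 (U b) (V b) / wave_right \<omega> B2 (U b) (V b)"
    using 2(2) by (simp add: c)
  show "refl_coeff b c \<eta> \<omega> \<xi> \<in> ball 0 1" unfolding eq2 using 2(1) by (rule ball)
  show "disk_auto 1 (of_real ((B1 - B2) / (B1 + B2))) (refl_coeff b c \<eta> \<omega> \<xi>) \<in> ball 0 1"
    unfolding eq2 t(2) using t(1) by (rule ball)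
  show "refl_coeff a c \<eta> \<omega> \<xi> =
      refl_coeff a b \<eta> \<omega> (disk_auto 1 (of_real ((B1 - B2) / (B1 + B2))) (refl_coeff b c \<eta> \<omega> \<xi>))"
    unfolding eq2 t(2) 1(2) using 0(2) by (simp add: c)
qed

lemma refl_coeff_cong:
  assumes "\<And>x. x \<in> {a<..<b} \<Longrightarrow> \<eta>' x = \<eta> x"
  shows "refl_coeff a b \<eta>' = refl_coeff a b \<eta>"
proof -
  have "scattering_solution a b \<eta>' \<omega> \<xi> u = scattering_solution a b \<eta> \<omega> \<xi> u" for \<omega> \<xi> u
    unfolding scattering_solution_def AE_lebesgue_on_interval_iff using assms by simp
  then show ?thesis unfolding refl_coeff_def[abs_def] by simp
qed

subsection \<open>Regulated functions\<close>

lemma step_constant_on_connected: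
  assumes "\<forall>C\<in>components (Y - F). s constant_on C" "S \<subseteq> Y - F" "connected S" "x \<in> S" "y \<in> S"
  shows "s x = s y"
proof -
  obtain C where "C \<in> components (Y - F)" "S \<subseteq> C"
    using exists_component_superset[OF assms(2) _ assms(3)] assms(2,4) by blast
  then show ?thesis using assms(1,4,5) by (auto simp: constant_on_def subset_iff)
qed

text \<open>This is the Cauchy criterion along \<open>G\<close>: one sequence in \<open>G\<close>
  supplies the limit, and the oscillation bound carries it over to all of \<open>G\<close>.\<close>

lemma tendsto_within_of_small_oscillation:
  fixes f :: "real \<Rightarrow> real"
  assumes "p islimpt G" "p \<notin> G"
    and osc: "\<And>e. e > 0 \<Longrightarrow> \<exists>\<delta>>0. \<forall>x\<in>G. \<forall>y\<in>G. dist x p < \<delta> \<and> dist y p < \<delta> \<longrightarrow> dist (f x) (f y) \<le> e"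
  shows "\<exists>l. (f \<longlongrightarrow> l) (at p within G)"
proof -
  obtain X where X: "\<And>n::nat. X n \<in> G" "X \<longlonglongrightarrow> p"
    using assms(1) unfolding islimpt_sequential by blast
  have "Cauchy (\<lambda>n. f (X n))"
  proof (rule metric_CauchyI)
    fix e :: real assume "e > 0"
    then obtain \<delta> where \<delta>: "\<delta> > 0" "\<forall>x\<in>G. \<forall>y\<in>G. dist x p < \<delta> \<and> dist y p < \<delta> \<longrightarrow> dist (f x) (f y) \<le> e / 2"
      using osc[of "e / 2"] by auto
    obtain n0 where "\<And>n. n \<ge> n0 \<Longrightarrow> dist (X n) p < \<delta>" using X(2) \<delta>(1) unfolding lim_sequentially by blast
    then have "dist (f (X m)) (f (X n)) \<le> e / 2" if "m \<ge> n0" "n \<ge> n0" for m n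
      using \<delta>(2) X(1) that by blast
    moreover have "e / 2 < e" using \<open>e > 0\<close> by simp
    ultimately have "dist (f (X m)) (f (X n)) < e" if "m \<ge> n0" "n \<ge> n0" for m n
      using that le_less_trans by blast
    then show "\<exists>M. \<forall>m\<ge>M. \<forall>n\<ge>M. dist (f (X m)) (f (X n)) < e" by blast
  qed
  then obtain l where l: "(\<lambda>n. f (X n)) \<longlonglongrightarrow> l" using Cauchy_convergent unfolding convergent_def by blast
  have "(f \<longlongrightarrow> l) (at p within G)"
  proof (rule tendstoI)
    fix e :: real assume "e > 0"
    then obtain \<delta> where \<delta>: "\<delta> > 0" "\<forall>x\<in>G. \<forall>y\<in>G. dist x p < \<delta> \<and> dist y p < \<delta> \<longrightarrow> dist (f x) (f y) \<le> e / 2"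
      using osc[of "e / 2"] by auto
    have "dist (f x) l < e" if x: "x \<in> G" "dist x p < \<delta>" for x
    proof -
      have "\<forall>\<^sub>F n in sequentially. dist (X n) p < \<delta>" using X(2) \<delta>(1) by (rule tendstoD)
      then have ev: "\<forall>\<^sub>F n in sequentially. dist (f x) (f (X n)) \<le> e / 2"
        by (rule eventually_mono) (use \<delta>(2) X(1) x in blast)
      have "dist (f x) l \<le> e / 2"
        by (rule tendsto_upperbound[OF tendsto_dist[OF tendsto_const l] ev]) simp
      then show ?thesis using \<open>e > 0\<close> by simp
    qed
    then show "\<forall>\<^sub>F x in at p within G. dist (f x) l < e" unfolding eventually_at using \<delta>(1) by blast
  qed
  then show ?thesis ..
qed

lemma bounded_on_of_locally_bounded:
  fixes f :: "real \<Rightarrow> real"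
  assumes "G \<subseteq> {a..b}" and loc: "\<And>p. p \<in> {a..b} \<Longrightarrow> \<exists>\<delta>>0. \<exists>B. \<forall>x\<in>G. dist x p < \<delta> \<longrightarrow> \<bar>f x\<bar> \<le> B"
  shows "\<exists>B. \<forall>x\<in>G. \<bar>f x\<bar> \<le> B"
proof -
  obtain \<delta> B where \<delta>: "\<And>p. p \<in> {a..b} \<Longrightarrow> \<delta> p > 0"
    and B: "\<And>p x. p \<in> {a..b} \<Longrightarrow> x \<in> G \<Longrightarrow> dist x p < \<delta> p \<Longrightarrow> \<bar>f x\<bar> \<le> B p"
    using loc by metis
  have cover: "{a..b} \<subseteq> (\<Union>p\<in>{a..b}. ball p (\<delta> p))" using \<delta> by fastforce
  obtain P where P: "P \<subseteq> {a..b}" "finite P" "{a..b} \<subseteq> (\<Union>p\<in>P. ball p (\<delta> p))"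
    by (rule compactE_image[OF compact_Icc _ cover]) auto
  have "\<bar>f x\<bar> \<le> (\<Sum>p\<in>P. \<bar>B p\<bar>)" if "x \<in> G" for x
  proof -
    obtain p where p: "p \<in> P" "dist x p < \<delta> p"
      using P(3) \<open>x \<in> G\<close> assms(1) by (auto simp: dist_commute)
    then have "\<bar>f x\<bar> \<le> \<bar>B p\<bar>" using B[of p x] P(1) \<open>x \<in> G\<close> by fastforce
    also have "\<dots> \<le> (\<Sum>p\<in>P. \<bar>B p\<bar>)" using P(2) p(1) by (intro member_le_sum) auto
    finally show ?thesis .
  qed
  then show ?thesis by blast
qed

text \<open>For each \<open>n\<close> take a step function within \<open>inverse (Suc n)\<close> of
  \<eta>. The set \<open>G\<close> omits all exceptional null sets and all jump points, countably
  many sets in total. Near any point each step function is constant on either side, so \<eta>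
  oscillates there by at most \<open>2 * inverse (Suc n)\<close>; boundedness, continuity and end
  limits all follow from this.\<close>

lemma Reg_posE:
  assumes "\<eta> \<in> Reg_pos {a<..<b}" "a < b"
  obtains G m M A B where "G \<subseteq> {a<..<b}" "negligible ({a<..<b} - G)"
    "\<And>x. x \<in> G \<Longrightarrow> (\<eta> \<longlongrightarrow> \<eta> x) (at x within G)"
    "(\<eta> \<longlongrightarrow> A) (at a within G)" "(\<eta> \<longlongrightarrow> B) (at b within G)"
    "m > 0" "\<And>x. x \<in> G \<Longrightarrow> m \<le> \<eta> x \<and> \<eta> x \<le> M"
proof -
  let ?Y = "{a<..<b}"
  obtain m where m: "m > 0" "AE x in lebesgue_on ?Y. \<eta> x > m"
    using assms(1) by (auto simp: Reg_pos_def)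
  obtain N0 where N0: "negligible N0" "\<And>x. x \<in> ?Y - N0 \<Longrightarrow> \<eta> x > m"
    using m(2) unfolding AE_lebesgue_on_interval_iff by blast
  define P where "P n = (\<lambda>(s, F, N). finite F \<and> (\<forall>C\<in>components (?Y - F). s constant_on C) \<and>
      negligible N \<and> (\<forall>x\<in>?Y - N. norm (complex_of_real (\<eta> x) - s x) \<le> inverse (Suc n)))" for n
  have "\<exists>T. P n T" for n
  proof -
    have "inverse (real (Suc n)) > 0" by simp
    then obtain s where "s \<in> Step ?Y" and
      "AE x in lebesgue_on ?Y. norm (of_real (\<eta> x) - s x) \<le> inverse (Suc n)"
      using assms(1) unfolding Reg_pos_def Reg_def by blast
    then obtain F N where "P n (s, F, N)" unfolding Step_def AE_lebesgue_on_interval_iff P_def by blast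
    then show ?thesis ..
  qed
  then obtain T where T: "\<And>n. P n (T n)" by metis
  define s F N where "s n = fst (T n)" and "F n = fst (snd (T n))" and "N n = snd (snd (T n))" for n
  have F: "finite (F n)" and s: "\<forall>C\<in>components (?Y - F n). s n constant_on C"
    and N: "negligible (N n)"
    and approx: "\<And>x. x \<in> ?Y - N n \<Longrightarrow> norm (complex_of_real (\<eta> x) - s n x) \<le> inverse (Suc n)" for n
    using T[of n] by (auto simp: P_def s_def F_def N_def case_prod_unfold)
  define G where "G = ?Y - (N0 \<union> (\<Union>n. N n) \<union> (\<Union>n. F n))"
  have GY: "G \<subseteq> ?Y" by (auto simp: G_def)
  have "negligible (N0 \<union> (\<Union>n. N n) \<union> (\<Union>n. F n))"
    using N0(1) N F by (intro negligible_Un negligible_countable_Union) (auto intro: negligible_finite)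
  then have Gneg: "negligible (?Y - G)" by (rule negligible_subset) (auto simp: G_def)
  have approxG: "norm (complex_of_real (\<eta> x) - s n x) \<le> inverse (Suc n)" if "x \<in> G" for x n
    using approx[of x n] that by (auto simp: G_def)
  \<comment> \<open>In each of the three alternatives the segment between \<open>x\<close> and
    \<open>y\<close> avoids \<open>F n\<close>: either \<open>p\<close> is no jump point, or both
    points lie strictly on the same side of \<open>p\<close>.\<close>
  have near: "\<exists>\<delta>>0. \<forall>x\<in>G. \<forall>y\<in>G. dist x p < \<delta> \<and> dist y p < \<delta> \<and>
      (p \<in> ?Y - F n \<or> p < x \<and> p < y \<or> x < p \<and> y < p) \<longrightarrow> dist (\<eta> x) (\<eta> y) \<le> 2 * inverse (Suc n)" for p n
  proof -
    obtain \<delta> where \<delta>: "\<delta> > 0" "\<And>x. x \<in> F n \<Longrightarrow> x \<noteq> p \<Longrightarrow> \<delta> \<le> dist p x"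
      using finite_set_avoid[OF F] by metis
    have "dist (\<eta> x) (\<eta> y) \<le> 2 * inverse (Suc n)"
      if xy: "x \<in> G" "y \<in> G" "dist x p < \<delta>" "dist y p < \<delta>"
        "p \<in> ?Y - F n \<or> p < x \<and> p < y \<or> x < p \<and> y < p" for x y
    proof -
      have "closed_segment x y \<subseteq> ?Y - F n"
      proof
        fix z assume z: "z \<in> closed_segment x y"
        then have "z \<in> ?Y" using xy(1,2) GY by (auto simp: closed_segment_eq_real_ivl split: if_splits)
        moreover have "dist p z < \<delta>"
          using z xy(3,4) by (auto simp: closed_segment_eq_real_ivl dist_real_def split: if_splits)
        moreover have "z = p \<Longrightarrow> p \<notin> F n"
          using z xy(5) by (auto simp: closed_segment_eq_real_ivl split: if_splits)
        ultimately show "z \<in> ?Y - F n" using \<delta>(2)[of z] by force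
      qed
      then have "s n x = s n y" by (intro step_constant_on_connected[OF s]) auto
      then have "norm (complex_of_real (\<eta> x) - complex_of_real (\<eta> y)) \<le> inverse (Suc n) + inverse (Suc n)"
        using norm_triangle_ineq4[of "of_real (\<eta> x) - s n x" "of_real (\<eta> y) - s n y"]
          approxG[OF xy(1), of n] approxG[OF xy(2), of n] by simp
      then show ?thesis by (simp add: dist_norm flip: of_real_diff)
    qed
    then show ?thesis using \<delta>(1) by blast
  qed
  have small: "\<exists>n. 2 * inverse (real (Suc n)) < e" if e: "e > 0" for e
  proof -
    obtain n where "inverse (real (Suc n)) < e / 2" using reals_Archimedean[of "e / 2"] e by auto
    then have "2 * inverse (real (Suc n)) < e" by linarith
    then show ?thesis ..
  qed
  have "\<exists>M. \<forall>x\<in>G. \<bar>\<eta> x\<bar> \<le> M"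
  proof (rule bounded_on_of_locally_bounded[of G a b])
    show "G \<subseteq> {a..b}" using GY by auto
    fix p
    obtain \<delta> where \<delta>: "\<delta> > 0" and near0: "\<forall>x\<in>G. \<forall>y\<in>G. dist x p < \<delta> \<and> dist y p < \<delta> \<and>
      (p \<in> ?Y - F 0 \<or> p < x \<and> p < y \<or> x < p \<and> y < p) \<longrightarrow> dist (\<eta> x) (\<eta> y) \<le> 2 * inverse (Suc 0)"
      using near[of p 0] by blast
    have osc: "dist (\<eta> x) (\<eta> y) \<le> 2"
      if "x \<in> G" "y \<in> G" "dist x p < \<delta>" "dist y p < \<delta>" "p < x \<and> p < y \<or> x < p \<and> y < p" for x y
    proof -
      have "dist (\<eta> x) (\<eta> y) \<le> 2 * inverse (Suc 0)" using near0 that by blast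
      then show ?thesis by simp
    qed
    have bd: "\<exists>B. \<forall>x\<in>G. dist x p < \<delta> \<and> R x \<longrightarrow> \<bar>\<eta> x\<bar> \<le> B"
      if R: "\<And>x y. R x \<Longrightarrow> R y \<Longrightarrow> p < x \<and> p < y \<or> x < p \<and> y < p" for R
    proof (cases "\<exists>y\<in>G. dist y p < \<delta> \<and> R y")
      case True
      then obtain y where y: "y \<in> G" "dist y p < \<delta>" "R y" by blast
      have "\<bar>\<eta> x\<bar> \<le> \<bar>\<eta> y\<bar> + 2" if "x \<in> G" "dist x p < \<delta>" "R x" for x
        using osc[OF that(1) y(1) that(2) y(2) R[OF that(3) y(3)]] by (simp add: dist_real_def)
      then show ?thesis by blast
    qed blast
    obtain B1 B2 where B: "\<And>x. x \<in> G \<Longrightarrow> dist x p < \<delta> \<Longrightarrow> p < x \<Longrightarrow> \<bar>\<eta> x\<bar> \<le> B1"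
        "\<And>x. x \<in> G \<Longrightarrow> dist x p < \<delta> \<Longrightarrow> x < p \<Longrightarrow> \<bar>\<eta> x\<bar> \<le> B2"
      using bd[of "\<lambda>x. p < x"] bd[of "\<lambda>x. x < p"] by auto
    \<comment> \<open>The last summand covers the case \<open>x = p\<close>, which the two one-sided
      bounds leave open.\<close>
    have "\<bar>\<eta> x\<bar> \<le> \<bar>B1\<bar> + \<bar>B2\<bar> + \<bar>\<eta> p\<bar>" if "x \<in> G" "dist x p < \<delta>" for x
      using B[OF that] by (cases x p rule: linorder_cases) auto
    then show "\<exists>\<delta>>0. \<exists>B. \<forall>x\<in>G. dist x p < \<delta> \<longrightarrow> \<bar>\<eta> x\<bar> \<le> B" using \<delta> by blast
  qed
  then obtain M where M: "\<And>x. x \<in> G \<Longrightarrow> \<bar>\<eta> x\<bar> \<le> M" by blast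
  have cont: "(\<eta> \<longlongrightarrow> \<eta> x) (at x within G)" if x: "x \<in> G" for x
  proof (rule tendstoI)
    fix e :: real assume "e > 0"
    then obtain n where n: "2 * inverse (real (Suc n)) < e" using small by blast
    obtain \<delta> where \<delta>: "\<delta> > 0" "\<forall>y\<in>G. \<forall>z\<in>G. dist y x < \<delta> \<and> dist z x < \<delta> \<and>
      (x \<in> ?Y - F n \<or> x < y \<and> x < z \<or> y < x \<and> z < x) \<longrightarrow> dist (\<eta> y) (\<eta> z) \<le> 2 * inverse (Suc n)"
      using near[of x n] by blast
    have "x \<in> ?Y - F n" using x by (auto simp: G_def)
    moreover have "dist x x < \<delta>" using \<delta>(1) by simp
    ultimately have "dist (\<eta> y) (\<eta> x) \<le> 2 * inverse (Suc n)" if "y \<in> G" "dist y x < \<delta>" for y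
      using \<delta>(2) x that by blast
    then have "dist (\<eta> y) (\<eta> x) < e" if "y \<in> G" "dist y x < \<delta>" for y
      using n that by (rule_tac le_less_trans) auto
    then show "\<forall>\<^sub>F y in at x within G. dist (\<eta> y) (\<eta> x) < e"
      unfolding eventually_at using \<delta>(1) by blast
  qed
  have ends: "\<exists>l. (\<eta> \<longlongrightarrow> l) (at p within G)" if p: "p = a \<or> p = b" for p
  proof (rule tendsto_within_of_small_oscillation[of p G])
    show "p islimpt G" using assms(2) Gneg GY p by (rule islimpt_end_of_ae_set)
    show "p \<notin> G" using GY p by auto
    fix e :: real assume "e > 0"
    then obtain n where n: "2 * inverse (real (Suc n)) < e" using small by blast
    have side: "p < x \<and> p < y \<or> x < p \<and> y < p" if "x \<in> G" "y \<in> G" for x y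
      using that p GY by auto
    obtain \<delta> where \<delta>: "\<delta> > 0" "\<forall>x\<in>G. \<forall>y\<in>G. dist x p < \<delta> \<and> dist y p < \<delta> \<and>
      (p \<in> ?Y - F n \<or> p < x \<and> p < y \<or> x < p \<and> y < p) \<longrightarrow> dist (\<eta> x) (\<eta> y) \<le> 2 * inverse (Suc n)"
      using near[of p n] by blast
    have "dist (\<eta> x) (\<eta> y) \<le> e" if "x \<in> G" "y \<in> G" "dist x p < \<delta>" "dist y p < \<delta>" for x y
    proof -
      have "dist (\<eta> x) (\<eta> y) \<le> 2 * inverse (Suc n)" using \<delta>(2) side[OF that(1,2)] that by blast
      then show ?thesis using n by linarith
    qed
    then show "\<exists>\<delta>>0. \<forall>x\<in>G. \<forall>y\<in>G. dist x p < \<delta> \<and> dist y p < \<delta> \<longrightarrow> dist (\<eta> x) (\<eta> y) \<le> e"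
      using \<delta>(1) by blast
  qed
  obtain A B where "(\<eta> \<longlongrightarrow> A) (at a within G)" "(\<eta> \<longlongrightarrow> B) (at b within G)" using ends by blast
  moreover have "m \<le> \<eta> x \<and> \<eta> x \<le> M" if "x \<in> G" for x
    using N0(2)[of x] M[OF that] that by (auto simp: G_def)
  ultimately show ?thesis using that[OF GY Gneg cont] m(1) by blast
qed

subsection \<open>Constant factors and splitting of the coefficient\<close>

lemma abs_continuous_on_cmult:
  assumes "abs_continuous_on Y f"
  shows "abs_continuous_on Y (\<lambda>x. k * f x)"
proof (cases "k = 0")
  case False
  show ?thesis
    unfolding abs_continuous_on_def
  proof (intro allI impI)
    fix \<epsilon> :: real assume "\<epsilon> > 0"
    then have "\<epsilon> / norm k > 0" using False by simp
    then obtain \<delta> where \<delta>: "\<delta> > 0" and *: "\<And>d T. d division_of T \<and> T \<subseteq> Y \<and> (\<Sum>K\<in>d. Sup K - Inf K) < \<delta>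
       \<Longrightarrow> (\<Sum>K\<in>d. norm (f (Sup K) - f (Inf K))) < \<epsilon> / norm k"
      using assms unfolding abs_continuous_on_def by meson
    have eq: "(\<Sum>K\<in>d. norm (k * f (Sup K) - k * f (Inf K))) = norm k * (\<Sum>K\<in>d. norm (f (Sup K) - f (Inf K)))" for d
      by (simp add: sum_distrib_left norm_mult flip: right_diff_distrib)
    show "\<exists>\<delta>>0. \<forall>d T. d division_of T \<and> T \<subseteq> Y \<and> (\<Sum>K\<in>d. Sup K - Inf K) < \<delta>
       \<longrightarrow> (\<Sum>K\<in>d. norm (k * f (Sup K) - k * f (Inf K))) < \<epsilon>"
      unfolding eq using * \<delta> False by (intro exI[of _ \<delta>]) (auto simp: field_simps)
  qed
qed (simp add: lipschitz_on_imp_abs_continuous_on[OF lipschitz_on_constant])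

text \<open>A constant factor in \<eta> is absorbed by \<open>v\<close>; the function
  \<open>u\<close>, and with it both boundary conditions, stays the same.\<close>

lemma scattering_solution_cmult:
  assumes "scattering_solution a b \<eta> \<omega> \<xi> u"
  shows "scattering_solution a b (\<lambda>x. k * \<eta> x) \<omega> \<xi> u"
proof -
  obtain v where v: "abs_continuous_on {a<..<b} v" and ae: "AE x in lebesgue_on {a<..<b}.
          u differentiable (at x) \<and> v x = of_real (\<eta> x) * vector_derivative u (at x) \<and>
          v differentiable (at x) \<and>
          vector_derivative v (at x) + (of_real \<omega>)\<^sup>2 * of_real (\<eta> x) * u x = 0"
    using assms unfolding scattering_solution_def by blast
  let ?v = "\<lambda>x. of_real k * v x"
  have "AE x in lebesgue_on {a<..<b}.
          u differentiable (at x) \<and> ?v x = of_real (k * \<eta> x) * vector_derivative u (at x) \<and>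
          ?v differentiable (at x) \<and>
          vector_derivative ?v (at x) + (of_real \<omega>)\<^sup>2 * of_real (k * \<eta> x) * u x = 0"
    using ae
  proof (rule eventually_mono, elim conjE, intro conjI)
    fix x assume v: "v differentiable (at x)"
      "vector_derivative v (at x) + (of_real \<omega>)\<^sup>2 * of_real (\<eta> x) * u x = 0"
    have d: "(?v has_vector_derivative of_real k * vector_derivative v (at x)) (at x)"
      using v(1) by (intro has_vector_derivative_mult_right) (simp add: vector_derivative_works)
    then show "?v differentiable (at x)" by (rule differentiableI_vector)
    have "vector_derivative ?v (at x) + (of_real \<omega>)\<^sup>2 * of_real (k * \<eta> x) * u x =
        of_real k * (vector_derivative v (at x) + (of_real \<omega>)\<^sup>2 * of_real (\<eta> x) * u x)"
      using vector_derivative_at[OF d] by (simp add: algebra_simps)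
    then show "vector_derivative ?v (at x) + (of_real \<omega>)\<^sup>2 * of_real (k * \<eta> x) * u x = 0"
      using v(2) by simp
  qed auto
  moreover have "abs_continuous_on {a<..<b} ?v" using v by (rule abs_continuous_on_cmult)
  ultimately show ?thesis using assms unfolding scattering_solution_def by blast
qed

lemma refl_coeff_cmult:
  assumes "k \<noteq> 0"
  shows "refl_coeff a b (\<lambda>x. k * \<eta> x) = refl_coeff a b \<eta>"
proof -
  have "scattering_solution a b (\<lambda>x. k * \<eta> x) \<omega> \<xi> u \<longleftrightarrow> scattering_solution a b \<eta> \<omega> \<xi> u" for \<omega> \<xi> u
    using scattering_solution_cmult[of a b \<eta> \<omega> \<xi> u k]
      scattering_solution_cmult[of a b "\<lambda>x. k * \<eta> x" \<omega> \<xi> u "inverse k"] assms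
    by (auto simp flip: mult.assoc)
  then show ?thesis unfolding refl_coeff_def[abs_def] by simp
qed

text \<open>Continuity along \<open>G\<close> gives no information at \<open>b\<close>, a point
  outside \<open>G\<close> where \<eta> may jump. Hence the two limits at \<open>b\<close> are
  hypotheses.\<close>

lemma regular_coeff_split:
  assumes reg: "regular_coeff a c \<eta> G A C" and "a < b" "b < c" "b \<notin> G"
    and l: "(\<eta> \<longlongrightarrow> B1) (at b within G \<inter> {a<..<b})" "B1 > 0"
    and r: "(\<eta> \<longlongrightarrow> B2) (at b within G \<inter> {b<..<c})" "B2 > 0"
  shows "regular_coeff a b \<eta> (G \<inter> {a<..<b}) A B1" "regular_coeff b c \<eta> (G \<inter> {b<..<c}) B2 C"
proof -
  have "negligible ({a<..<b} - G \<inter> {a<..<b})" "negligible ({b<..<c} - G \<inter> {b<..<c})"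
    using reg assms(2,3) by (auto simp: regular_coeff_def intro: negligible_subset)
  moreover have "\<exists>m M. m > 0 \<and> (\<forall>x\<in>G \<inter> S. m \<le> \<eta> x \<and> \<eta> x \<le> M)" for S
    using reg unfolding regular_coeff_def by blast
  ultimately show "regular_coeff a b \<eta> (G \<inter> {a<..<b}) A B1" "regular_coeff b c \<eta> (G \<inter> {b<..<c}) B2 C"
    using assms unfolding regular_coeff_def by (simp_all, auto intro: tendsto_within_subset)
qed

section \<open>The two identities, with and without a jump of the coefficient\<close>

theorem proposition2p9:
  fixes x0 x1 x2 c r :: real and \<zeta> \<zeta>t \<zeta>1 \<zeta>2 :: "real \<Rightarrow> real"
  assumes "x0 < x1" and "x1 < x2"
    and "\<zeta> \<in> Reg_pos {x0<..<x2}" and "ae_continuous_at {x0<..<x2} \<zeta> x1"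
    and "c > -1"
    and "\<zeta>t \<in> Step_pos {x0<..<x2}"
    and "\<And>x. x \<in> {x0<..<x2} \<Longrightarrow> \<zeta>t x = 1 + c * heaviside (x - x1)"
    and "\<zeta>1 = restrict \<zeta> {x0<..<x1}" and "\<zeta>2 = restrict \<zeta> {x1<..<x2}"
    and "r = (Lim (at_left x1) \<zeta>t - Lim (at_right x1) \<zeta>t) /
             (Lim (at_left x1) \<zeta>t + Lim (at_right x1) \<zeta>t)"
  shows "(AE \<omega> in lebesgue. \<forall>\<xi> \<in> ball 0 1.
            refl_coeff x0 x2 \<zeta> \<omega> \<xi> =
              (refl_coeff x0 x1 \<zeta>1 \<omega> \<circ>\<^sub>D refl_coeff x1 x2 \<zeta>2 \<omega>) \<xi>) \<and>
         (AE \<omega> in lebesgue. \<forall>\<xi> \<in> ball 0 1.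
            refl_coeff x0 x2 (\<lambda>x. \<zeta> x * \<zeta>t x) \<omega> \<xi> =
              (refl_coeff x0 x1 \<zeta>1 \<omega> \<circ>\<^sub>D disk_auto 1 (of_real r) \<circ>\<^sub>D refl_coeff x1 x2 \<zeta>2 \<omega>) \<xi>)"
proof -
  let ?\<eta> = "\<lambda>x. \<zeta> x * \<zeta>t x"
  have x02: "x0 < x2" using assms(1,2) by simp
  have \<zeta>t: "\<zeta>t x = 1" if "x \<in> {x0<..<x1}" for x using assms(2,7) that by (simp add: heaviside_def)
  have \<zeta>t': "\<zeta>t x = 1 + c" if "x \<in> {x1<..<x2}" for x using assms(1,7) that by (simp add: heaviside_def)
  obtain G0 m M A C where G0: "G0 \<subseteq> {x0<..<x2}" "negligible ({x0<..<x2} - G0)"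
    "\<And>x. x \<in> G0 \<Longrightarrow> (\<zeta> \<longlongrightarrow> \<zeta> x) (at x within G0)"
    "(\<zeta> \<longlongrightarrow> A) (at x0 within G0)" "(\<zeta> \<longlongrightarrow> C) (at x2 within G0)"
    and m: "m > 0" "\<And>x. x \<in> G0 \<Longrightarrow> m \<le> \<zeta> x \<and> \<zeta> x \<le> M"
    using Reg_posE[OF assms(3) x02] by metis
  obtain h where h: "AE y in lebesgue_on {x0<..<x2}. h y = \<zeta> y" "isCont h x1"
    using assms(4) unfolding ae_continuous_at_def by blast
  obtain N where N: "negligible N" "\<And>x. x \<in> {x0<..<x2} - N \<Longrightarrow> h x = \<zeta> x"
    using h(1) unfolding AE_lebesgue_on_interval_iff by blast
  \<comment> \<open>Off \<open>N\<close> the function \<zeta> agrees with its representative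
    \<open>h\<close>, which is continuous at \<open>x1\<close>. The point \<open>x1\<close> is
    removed so that the product with \<open>\<zeta>t\<close> is still continuous along
    \<open>G\<close>.\<close>
  define G where "G = G0 - N - {x1}"
  define B where "B = h x1"
  have G: "G \<subseteq> G0" "x1 \<notin> G" "\<And>x. x \<in> G \<Longrightarrow> h x = \<zeta> x" "G \<subseteq> {x0<..<x2}"
    using N(2) G0(1) by (auto simp: G_def)
  have Gneg: "negligible ({x0<..<x2} - G)"
  proof (rule negligible_subset)
    show "negligible (({x0<..<x2} - G0) \<union> N \<union> {x1})"
      using G0(2) N(1) by (intro negligible_Un) auto
  qed (auto simp: G_def)
  have GB: "(\<zeta> \<longlongrightarrow> B) (at x1 within G)"
  proof (rule Lim_transform_eventually)
    show "(h \<longlongrightarrow> B) (at x1 within G)"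
      using h(2) unfolding B_def isCont_def by (rule tendsto_within_subset) simp
    show "\<forall>\<^sub>F x in at x1 within G. h x = \<zeta> x"
      unfolding eventually_at using G(3) by (auto intro: exI[of _ 1])
  qed
  \<comment> \<open>Limits along subsets of \<open>G0\<close> inherit the lower bound
    \<open>m\<close>, so the three limits \<open>A\<close>, \<open>B\<close> and \<open>C\<close>
    are positive.\<close>
  have lb: "m \<le> l" if "(\<zeta> \<longlongrightarrow> l) (at p within S)" "S \<subseteq> G0" "p islimpt S" for l p S
  proof (rule tendsto_lowerbound[OF that(1)])
    show "\<forall>\<^sub>F x in at p within S. m \<le> \<zeta> x"
      unfolding eventually_at using m(2) that(2) by (intro exI[of _ 1]) auto
  qed (use that(3) in \<open>simp add: trivial_limit_within\<close>)
  have G1neg: "negligible ({x0<..<x1} - G \<inter> {x0<..<x1})"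
    by (rule negligible_subset[OF Gneg]) (use assms(2) in auto)
  have "x1 islimpt G \<inter> {x0<..<x1}"
    using assms(1) G1neg by (intro islimpt_end_of_ae_set[of x0 x1]) auto
  then have Bpos: "B > 0"
    using lb[OF tendsto_within_subset[OF GB]] G(1) m(1) by (smt (verit) inf.coboundedI1 inf_le1)
  have "x0 islimpt G0" "x2 islimpt G0"
    using x02 G0(1,2) by (auto intro: islimpt_end_of_ae_set[of x0 x2])
  then have ACpos: "A > 0" "C > 0"
    using lb[OF G0(4)] lb[OF G0(5)] m(1) by auto
  have lim\<zeta>: "(\<zeta> \<longlongrightarrow> \<zeta> x) (at x within G)" if "x \<in> G" for x
    using G0(3)[of x] that G(1) by (blast intro: tendsto_within_subset)
  have lim\<zeta>e: "(\<zeta> \<longlongrightarrow> A) (at x0 within G)" "(\<zeta> \<longlongrightarrow> C) (at x2 within G)"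
    using G0(4,5) G(1) by (blast intro: tendsto_within_subset)+
  have reg: "regular_coeff x0 x2 \<zeta> G A C"
    unfolding regular_coeff_def using x02 G Gneg lim\<zeta> lim\<zeta>e ACpos m by blast
  note reg12 = regular_coeff_split[OF reg assms(1,2) G(2)
      tendsto_within_subset[OF GB Int_lower1] Bpos tendsto_within_subset[OF GB Int_lower1] Bpos]

  have ev: "\<forall>\<^sub>F x in at p within S. \<zeta>t x = k"
    if "open T" "p \<in> T" "\<And>x. x \<in> S \<inter> T \<Longrightarrow> x \<noteq> p \<Longrightarrow> \<zeta>t x = k" for p S T k
    unfolding eventually_at_topological using that by blast
  have lim\<zeta>t: "(?\<eta> \<longlongrightarrow> l * k) (at p within S)"
    if "(\<zeta> \<longlongrightarrow> l) (at p within S)" "\<forall>\<^sub>F x in at p within S. \<zeta>t x = k" for l p S k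
    using that by (intro tendsto_mult) (auto intro: tendsto_eventually)
  \<comment> \<open>Near each point of \<open>G\<close>, and along \<open>G\<close> near both ends,
    \<open>\<zeta>t\<close> is constant, so it contributes only a factor 1 or \<open>1 + c\<close>
    to each limit.\<close>
  have reg': "regular_coeff x0 x2 ?\<eta> G A (C * (1 + c))"
    unfolding regular_coeff_def
  proof (intro conjI ballI)
    fix x assume x: "x \<in> G"
    show "(?\<eta> \<longlongrightarrow> \<zeta> x * \<zeta>t x) (at x within G)"
    proof (cases "x < x1")
      case True
      then show ?thesis
        using x G(4) \<zeta>t by (intro lim\<zeta>t lim\<zeta> ev[of "{x0<..<x1}"]) (auto simp: subset_iff)
    next
      case False
      then have "x1 < x" using x G(2) by (metis linorder_less_linear)
      then show ?thesis
        using x G(4) \<zeta>t' by (intro lim\<zeta>t lim\<zeta> ev[of "{x1<..<x2}"]) (auto simp: subset_iff)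
    qed
  next
    have "(?\<eta> \<longlongrightarrow> A * 1) (at x0 within G)"
      using G(4) \<zeta>t assms(1) by (intro lim\<zeta>t lim\<zeta>e ev[of "{..<x1}"]) (auto simp: subset_iff)
    then show "(?\<eta> \<longlongrightarrow> A) (at x0 within G)" by simp
    show "(?\<eta> \<longlongrightarrow> C * (1 + c)) (at x2 within G)"
      using G(4) \<zeta>t' assms(2) by (intro lim\<zeta>t lim\<zeta>e ev[of "{x1<..}"]) (auto simp: subset_iff)
    show "\<exists>m M. 0 < m \<and> (\<forall>x\<in>G. m \<le> ?\<eta> x \<and> ?\<eta> x \<le> M)"
    proof (intro exI conjI ballI)
      show "0 < m * min 1 (1 + c)" using m(1) assms(5) by simp
      fix x assume x: "x \<in> G"
      then have "\<zeta>t x = 1 \<or> \<zeta>t x = 1 + c"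
        using \<zeta>t[of x] \<zeta>t'[of x] G(2,4) by (cases x x1 rule: linorder_cases) (auto simp: subset_iff)
      then have "min 1 (1 + c) \<le> \<zeta>t x" "\<zeta>t x \<le> max 1 (1 + c)" "\<zeta>t x > 0" using assms(5) by auto
      moreover have "m \<le> \<zeta> x" "\<zeta> x \<le> M" using m(2)[of x] x G(1) by auto
      ultimately show "m * min 1 (1 + c) \<le> ?\<eta> x" "?\<eta> x \<le> M * max 1 (1 + c)"
        using m(1) assms(5) by (auto intro!: mult_mono)
    qed
  qed (use x02 G Gneg ACpos assms(5) in auto)
  have B12: "(?\<eta> \<longlongrightarrow> B) (at x1 within G \<inter> {x0<..<x1})" "(?\<eta> \<longlongrightarrow> B * (1 + c)) (at x1 within G \<inter> {x1<..<x2})"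
  proof -
    have "(?\<eta> \<longlongrightarrow> B * 1) (at x1 within G \<inter> {x0<..<x1})"
      using \<zeta>t by (intro lim\<zeta>t tendsto_within_subset[OF GB] ev[of UNIV]) auto
    then show "(?\<eta> \<longlongrightarrow> B) (at x1 within G \<inter> {x0<..<x1})" by simp
    show "(?\<eta> \<longlongrightarrow> B * (1 + c)) (at x1 within G \<inter> {x1<..<x2})"
      using \<zeta>t' by (intro lim\<zeta>t tendsto_within_subset[OF GB] ev[of UNIV]) auto
  qed
  have B2pos: "B * (1 + c) > 0" using Bpos assms(5) by simp
  note reg12' = regular_coeff_split[OF reg' assms(1,2) G(2) B12(1) Bpos B12(2) B2pos]

  have "Lim (at_left x1) \<zeta>t = 1"
  proof (intro tendsto_Lim tendsto_eventually)
    show "\<forall>\<^sub>F x in at_left x1. \<zeta>t x = 1"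
      using assms(1) \<zeta>t by (intro ev[of "{x0<..}"]) auto
  qed simp
  moreover have "Lim (at_right x1) \<zeta>t = 1 + c"
  proof (intro tendsto_Lim tendsto_eventually)
    show "\<forall>\<^sub>F x in at_right x1. \<zeta>t x = 1 + c"
      using assms(2) \<zeta>t' by (intro ev[of "{..<x2}"]) auto
  qed simp
  \<comment> \<open>The common limit \<open>B\<close> of \<zeta> cancels, which identifies
    \<open>r\<close> with the parameter for the limits of the product.\<close>
  ultimately have r: "r = (B - B * (1 + c)) / (B + B * (1 + c))"
    using assms(10) Bpos mult_divide_mult_cancel_left[of B "1 - (1 + c)" "1 + (1 + c)"]
    by (simp add: algebra_simps)
  have refl1: "refl_coeff x0 x1 \<zeta>1 = refl_coeff x0 x1 \<zeta>"
    unfolding assms(8) by (rule refl_coeff_cong) simp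
  have refl2: "refl_coeff x1 x2 \<zeta>2 = refl_coeff x1 x2 \<zeta>"
    unfolding assms(9) by (rule refl_coeff_cong) simp
  have refl1': "refl_coeff x0 x1 ?\<eta> = refl_coeff x0 x1 \<zeta>"
    by (rule refl_coeff_cong) (simp add: \<zeta>t)
  \<comment> \<open>On the right interval \<open>\<zeta>t\<close> is the constant
    \<open>1 + c\<close>, nonzero as \<open>c > -1\<close>, and a constant factor does not change
    the reflection coefficient.\<close>
  have refl2': "refl_coeff x1 x2 ?\<eta> = refl_coeff x1 x2 \<zeta>"
  proof -
    have "refl_coeff x1 x2 ?\<eta> = refl_coeff x1 x2 (\<lambda>x. (1 + c) * \<zeta> x)"
      by (rule refl_coeff_cong) (simp add: \<zeta>t')
    also have "\<dots> = refl_coeff x1 x2 \<zeta>" using assms(5) by (intro refl_coeff_cmult) simp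
    finally show ?thesis .
  qed
  have AE0: "AE \<omega> in lebesgue. \<omega> \<noteq> (0::real)"
    by (subst eventually_ae_filter_negligible) (intro exI[of _ "{0}"], simp)
  have "AE \<omega> in lebesgue. \<forall>\<xi> \<in> ball 0 1.
            refl_coeff x0 x2 \<zeta> \<omega> \<xi> =
              (refl_coeff x0 x1 \<zeta>1 \<omega> \<circ>\<^sub>D refl_coeff x1 x2 \<zeta>2 \<omega>) \<xi>"
    using AE0
  proof (rule eventually_mono, intro ballI)
    fix \<omega> :: real and \<xi> :: complex assume "\<omega> \<noteq> 0" "\<xi> \<in> ball 0 1"
    \<comment> \<open>Here both limits at \<open>x1\<close> equal \<open>B\<close>, so the middle
      factor is the identity.\<close>
    note comp = refl_coeff_composition[OF reg reg12 this]
    show "refl_coeff x0 x2 \<zeta> \<omega> \<xi> = (refl_coeff x0 x1 \<zeta>1 \<omega> \<circ>\<^sub>D refl_coeff x1 x2 \<zeta>2 \<omega>) \<xi>"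
      using comp(3) disk_comp_eq[where g = "refl_coeff x1 x2 \<zeta> \<omega>" and z = \<xi> and f = "refl_coeff x0 x1 \<zeta> \<omega>"] comp(1) by (simp add: refl1 refl2 disk_auto_def)
  qed
  moreover have "AE \<omega> in lebesgue. \<forall>\<xi> \<in> ball 0 1.
            refl_coeff x0 x2 (\<lambda>x. \<zeta> x * \<zeta>t x) \<omega> \<xi> =
              (refl_coeff x0 x1 \<zeta>1 \<omega> \<circ>\<^sub>D disk_auto 1 (of_real r) \<circ>\<^sub>D refl_coeff x1 x2 \<zeta>2 \<omega>) \<xi>"
    using AE0
  proof (rule eventually_mono, intro ballI)
    fix \<omega> :: real and \<xi> :: complex assume "\<omega> \<noteq> 0" "\<xi> \<in> ball 0 1"
    note comp = refl_coeff_composition[OF reg' reg12' this, folded r, unfolded refl1' refl2']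
    \<comment> \<open>The composition associates to the right, so it is evaluated from the inside;
      \<open>comp(1)\<close> and \<open>comp(2)\<close> place the two intermediate values in the
      open disk.\<close>
    have "(disk_auto 1 (of_real r) \<circ>\<^sub>D refl_coeff x1 x2 \<zeta> \<omega>) \<xi> = disk_auto 1 (of_real r) (refl_coeff x1 x2 \<zeta> \<omega> \<xi>)"
      using comp(1) by (rule disk_comp_eq)
    with comp(2,3) disk_comp_eq[of "disk_auto 1 (of_real r) \<circ>\<^sub>D refl_coeff x1 x2 \<zeta> \<omega>" \<xi> "refl_coeff x0 x1 \<zeta> \<omega>"]
    show "refl_coeff x0 x2 ?\<eta> \<omega> \<xi> =
              (refl_coeff x0 x1 \<zeta>1 \<omega> \<circ>\<^sub>D disk_auto 1 (of_real r) \<circ>\<^sub>D refl_coeff x1 x2 \<zeta>2 \<omega>) \<xi>"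
      by (simp only: refl1 refl2)
  qed
  ultimately show ?thesis ..
qed

end
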